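(* Let $\alpha:[0,\infty)\to(0,\infty)$ be continuously differentiable and write $\alpha^*(t):=\sup_{0\le r\le t}\alpha(r)$. Assume: (i) there are $\gamma\in[0,1/2]$, $\beta>0$ and a constant $C>0$ such that $\dfrac{(\alpha^*(t+1))^{2\gamma}}{\alpha(t)}\le C\,t^{-\beta}$ for all $0\le t<\infty$ (with $0^{-\beta}:=+\infty$); (ii) there is a constant $C>0$ such that $\sup_{t\ge0}\left|\dfrac{\alpha'(t)}{\alpha(t)}\right|\le C$. Define $$X_t:=\int_0^t\exp\left(-\int_s^t\alpha(u)\,du\right)dW_s\quad(0\le t<\infty),\qquad X_\infty:=0 .$$ Then $(X_t)_{0\le t\le\infty}$ is a centered Gaussian process with almost surely continuous sample paths on the closed infinite time horizon $[0,\infty]$ (in particular $\lim_{t\to\infty}X_t=0$ almost surely).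
   Context: $W=(W_t)_{t\ge0}$ is a standard one-dimensional Brownian motion on a complete filtered probability space. For $t<\infty$, $X_t$ is the solution of $dX_t=-\alpha(t)X_t\,dt+dW_t$, $X_0=0$, and we take its continuous version on $[0,\infty)$. Continuity on $[0,\infty]$ means continuity on $[0,\infty)$ together with $X_t\to X_\infty$ as $t\to\infty$. *)

theory Defs
  imports "HOL-Probability.Probability"
begin

locale complete_filtered_prob_space = prob_space M + complete_measure M
  for M :: "'a measure" +
  fixes F :: "real \<Rightarrow> 'a measure"
  assumes subalgebra_filtration: "0 \<le> t \<Longrightarrow> subalgebra M (F t)"
    and filtration_mono: "0 \<le> s \<Longrightarrow> s \<le> t \<Longrightarrow> sets (F s) \<subseteq> sets (F t)"
    and null_sets_filtration: "null_sets M \<subseteq> sets (F 0)"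

locale standard_brownian_motion = complete_filtered_prob_space M F
  for M :: "'a measure" and F :: "real \<Rightarrow> 'a measure" +
  fixes W :: "real \<Rightarrow> 'a \<Rightarrow> real"
  assumes adapted: "0 \<le> t \<Longrightarrow> W t \<in> borel_measurable (F t)"
    and start_zero: "AE \<omega> in M. W 0 \<omega> = 0"
    and increment_indep: "0 \<le> s \<Longrightarrow> s < t \<Longrightarrow>
      indep_set (sets (F s)) (sets (vimage_algebra (space M) (\<lambda>\<omega>. W t \<omega> - W s \<omega>) borel))"
    and increment_normal: "0 \<le> s \<Longrightarrow> s < t \<Longrightarrow>
      distributed M lborel (\<lambda>\<omega>. W t \<omega> - W s \<omega>) (normal_density 0 (sqrt (t - s)))"
    and continuous_paths: "AE \<omega> in M. continuous_on {0..} (\<lambda>t. W t \<omega>)"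

definition partition_of :: "real \<Rightarrow> nat \<Rightarrow> (nat \<Rightarrow> real) \<Rightarrow> bool" where
  "partition_of t n \<tau> \<longleftrightarrow> \<tau> 0 = 0 \<and> \<tau> n = t \<and> (\<forall>i<n. \<tau> i \<le> \<tau> (Suc i))"

definition step_fun :: "nat \<Rightarrow> (nat \<Rightarrow> real) \<Rightarrow> (nat \<Rightarrow> real) \<Rightarrow> real \<Rightarrow> real" where
  "step_fun n \<tau> c s = (\<Sum>i<n. c i * indicator {\<tau> i<..\<tau> (Suc i)} s)"

definition step_integral ::
  "(real \<Rightarrow> 'a \<Rightarrow> real) \<Rightarrow> nat \<Rightarrow> (nat \<Rightarrow> real) \<Rightarrow> (nat \<Rightarrow> real) \<Rightarrow> 'a \<Rightarrow> real" where
  "step_integral W n \<tau> c \<omega> = (\<Sum>i<n. c i * (W (\<tau> (Suc i)) \<omega> - W (\<tau> i) \<omega>))"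

text \<open>
  \<open>is_wiener_integral M W t f Y\<close> says that \<open>Y\<close> is a version of the stochastic integral over
  \<open>[0, t]\<close> of the deterministic integrand \<open>f\<close> with respect to \<open>W\<close>: the limit in \<open>L\<^sup>2(M)\<close> of the
  elementary integrals of step functions that converge to \<open>f\<close> in \<open>L\<^sup>2([0, t])\<close>. For a Brownian
  motion \<open>W\<close> the Ito isometry makes the limit independent of the approximating sequence, so
  \<open>Y\<close> is determined up to almost sure equality.
\<close>

definition is_wiener_integral ::
  "'a measure \<Rightarrow> (real \<Rightarrow> 'a \<Rightarrow> real) \<Rightarrow> real \<Rightarrow> (real \<Rightarrow> real) \<Rightarrow> ('a \<Rightarrow> real) \<Rightarrow> bool" where
  "is_wiener_integral M W t f Y \<longleftrightarrow>
     set_borel_measurable lborel {0..t} f \<and> Y \<in> borel_measurable M \<and>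
     (\<exists>n \<tau> c. (\<forall>k. partition_of t (n k) (\<tau> k)) \<and>
        (\<lambda>k. \<integral>\<^sup>+s\<in>{0..t}. ennreal ((f s - step_fun (n k) (\<tau> k) (c k) s)\<^sup>2) \<partial>lborel)
          \<longlonglongrightarrow> 0 \<and>
        (\<lambda>k. \<integral>\<^sup>+\<omega>. ennreal ((Y \<omega> - step_integral W (n k) (\<tau> k) (c k) \<omega>)\<^sup>2) \<partial>M)
          \<longlonglongrightarrow> 0)"

text \<open>Point masses count as Gaussian laws, with variance 0.\<close>

definition gaussian_rv :: "'a measure \<Rightarrow> ('a \<Rightarrow> real) \<Rightarrow> bool" where
  "gaussian_rv M Z \<longleftrightarrow> Z \<in> borel_measurable M \<and>
     (\<exists>\<mu> \<sigma>. 0 \<le> \<sigma> \<and> distr M borel Z =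
        (if \<sigma> = 0 then return borel \<mu> else density lborel (normal_density \<mu> \<sigma>)))"

definition gaussian_process :: "'a measure \<Rightarrow> 'i set \<Rightarrow> ('i \<Rightarrow> 'a \<Rightarrow> real) \<Rightarrow> bool" where
  "gaussian_process M I X \<longleftrightarrow>
     (\<forall>J c. finite J \<and> J \<subseteq> I \<longrightarrow> gaussian_rv M (\<lambda>\<omega>. \<Sum>i\<in>J. c i * X i \<omega>))"

definition centered_gaussian_process :: "'a measure \<Rightarrow> 'i set \<Rightarrow> ('i \<Rightarrow> 'a \<Rightarrow> real) \<Rightarrow> bool" where
  "centered_gaussian_process M I X \<longleftrightarrow>
     gaussian_process M I X \<and> (\<forall>i\<in>I. integral\<^sup>L M (X i) = 0)"

text \<open>The closed time horizon \<open>[0, \<infinity>]\<close> is the type \<^typ>\<open>ennreal\<close>.\<close>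

definition continuous_on_closed_horizon :: "(ennreal \<Rightarrow> real) \<Rightarrow> bool" where
  "continuous_on_closed_horizon x \<longleftrightarrow>
     continuous_on {0..} (\<lambda>t::real. x (ennreal t)) \<and>
     ((\<lambda>t::real. x (ennreal t)) \<longlongrightarrow> x \<infinity>) at_top"

definition running_sup :: "(real \<Rightarrow> real) \<Rightarrow> real \<Rightarrow> real" where
  "running_sup \<alpha> t = (SUP r\<in>{0..t}. \<alpha> r)"

end

theory Submission
  imports Defs
begin

text \<open>
  Gaussianity: finite combinations of the \<open>X\<^sub>t\<close> are \<open>L\<^sup>2\<close> limits of finite combinations of values of
  \<open>W\<close>, and centered normal laws are closed under such limits.

  Decay: condition (i) gives \<open>\<alpha>(t) \<ge> c t\<^sup>\<beta>\<close>. Put \<open>u(s) = \<integral>\<^sub>s\<^sup>t \<alpha>\<close>. Summation by parts expresses \<open>X\<^sub>t\<close>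
  through the increments \<open>W\<^sub>t - W\<^sub>s\<close> integrated against \<open>d (exp (- u(s)))\<close>, so a pathwise bound
  \<open>|W\<^sub>t - W\<^sub>s| \<le> B (a + d u(s))\<close> for all \<open>s \<le> t\<close> yields \<open>|X\<^sub>t| \<le> B (a + d)\<close>. A Borel-Cantelli
  argument over dyadic grids of mesh \<open>2\<^sup>-\<^sup>k\<close> on the growing intervals \<open>[0, 2\<^sup>m\<^sup>k]\<close>, followed by chaining,
  gives \<open>|W\<^sub>t - W\<^sub>s| \<le> 2\<^sup>-\<^sup>K\<^sup>/\<^sup>4 (a + 2\<^sup>K (t - s))\<close> for \<open>t < 2\<^sup>m\<^sup>K\<close> and \<open>K\<close> large. If moreover
  \<open>t \<ge> 2\<^sup>m\<^sup>(\<^sup>K\<^sup>-\<^sup>1\<^sup>)\<close> and \<open>m \<beta> \<ge> 1\<close>, then \<open>2\<^sup>K (t - s) \<le> d u(s)\<close>, so \<open>|X\<^sub>t|\<close> is of order \<open>2\<^sup>-\<^sup>K\<^sup>/\<^sup>4\<close>.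
  This holds almost surely for all rational \<open>t\<close>, hence for all \<open>t\<close> by continuity.
\<close>

section \<open>Centered normal variables and their limits\<close>

text \<open>Convergence in L2 is convergence in L1 of the squared differences, and an L1 null
  sequence has a subsequence tending to 0 almost everywhere.\<close>

lemma L2_limit_AE_subseq:
  fixes Z :: "nat \<Rightarrow> 'a \<Rightarrow> real"
  assumes [measurable]: "\<And>n. Z n \<in> borel_measurable M" "Y \<in> borel_measurable M"
    and lim: "(\<lambda>n. \<integral>\<^sup>+\<omega>. ennreal ((Y \<omega> - Z n \<omega>)\<^sup>2) \<partial>M) \<longlonglongrightarrow> 0"
  shows "\<exists>r::nat \<Rightarrow> nat. strict_mono r \<and> (AE \<omega> in M. (\<lambda>n. Z (r n) \<omega>) \<longlonglongrightarrow> Y \<omega>)"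
proof -
  have "eventually (\<lambda>n. (\<integral>\<^sup>+\<omega>. ennreal ((Y \<omega> - Z n \<omega>)\<^sup>2) \<partial>M) < 1) sequentially"
    by (rule order_tendstoD(2)[OF lim]) simp
  then obtain N where N: "\<And>n. n \<ge> N \<Longrightarrow> (\<integral>\<^sup>+\<omega>. ennreal ((Y \<omega> - Z n \<omega>)\<^sup>2) \<partial>M) < 1"
    by (auto simp: eventually_sequentially)
  \<comment> \<open>The shift by \<open>N\<close> makes every square integrable; before
    \<open>N\<close> the integrals may be infinite.\<close>
  define u where "u n \<omega> = (Y \<omega> - Z (n + N) \<omega>)\<^sup>2" for n \<omega>
  have [measurable]: "u n \<in> borel_measurable M" for n
    unfolding u_def by measurable
  have u_nonneg: "0 \<le> u n \<omega>" for n \<omega> by (simp add: u_def)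
  have int: "integrable M (u n)" for n
  proof (rule integrableI_nonneg)
    show "(\<integral>\<^sup>+ x. ennreal (u n x) \<partial>M) < \<infinity>"
      using order_less_trans[OF N[of "n + N"]] unfolding u_def by simp
  qed (auto simp: u_def)
  have "(\<lambda>n. \<integral>\<^sup>+\<omega>. ennreal (u n \<omega>) \<partial>M) \<longlonglongrightarrow> ennreal 0"
    using LIMSEQ_ignore_initial_segment[OF lim, of N] by (simp add: u_def)
  then have "(\<lambda>n. ennreal (\<integral>\<omega>. u n \<omega> \<partial>M)) \<longlonglongrightarrow> ennreal 0"
    using nn_integral_eq_integral[OF int] u_nonneg by simp
  then have "(\<lambda>n. \<integral>\<omega>. u n \<omega> \<partial>M) \<longlonglongrightarrow> 0"
    by (subst (asm) tendsto_ennreal_iff) (auto simp: u_nonneg)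
  then have "(\<lambda>n. \<integral>\<omega>. norm (u n \<omega>) \<partial>M) \<longlonglongrightarrow> 0"
    by (simp add: u_nonneg)
  from tendsto_L1_AE_subseq[OF int this]
  obtain r :: "nat \<Rightarrow> nat" where r: "strict_mono r" "AE x in M. (\<lambda>n. u (r n) x) \<longlonglongrightarrow> 0" by auto
  have "AE \<omega> in M. (\<lambda>n. Z (r n + N) \<omega>) \<longlonglongrightarrow> Y \<omega>"
    using r(2)
  proof eventually_elim
    case (elim \<omega>)
    then have "(\<lambda>n. sqrt (u (r n) \<omega>)) \<longlonglongrightarrow> sqrt 0" by (rule tendsto_real_sqrt)
    then have "(\<lambda>n. \<bar>Y \<omega> - Z (r n + N) \<omega>\<bar>) \<longlonglongrightarrow> 0" by (simp add: u_def)
    then have "(\<lambda>n. Y \<omega> - Z (r n + N) \<omega>) \<longlonglongrightarrow> 0" by (simp add: tendsto_rabs_zero_iff)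
    from tendsto_diff[OF tendsto_const[of "Y \<omega>"] this] show ?case by simp
  qed
  moreover have "strict_mono (\<lambda>n. r n + N)" using r(1) by (auto simp: strict_mono_def)
  ultimately show ?thesis by (intro exI[of _ "\<lambda>n. r n + N"]) auto
qed

text \<open>The characteristic function suits what follows: independent sums become products, limits
  of variables become pointwise limits, and the point mass at 0 is the case \<open>v = 0\<close>
  rather than an exception.\<close>

definition centered_normal :: "'a measure \<Rightarrow> real \<Rightarrow> ('a \<Rightarrow> real) \<Rightarrow> bool" where
  "centered_normal M v Z \<longleftrightarrow> Z \<in> borel_measurable M \<and> 0 \<le> v \<and>
     (\<forall>u. char (distr M borel Z) u = of_real (exp (- (v * u\<^sup>2) / 2)))"

context prob_space
begin

lemma char_distr:
  assumes [measurable]: "Z \<in> borel_measurable M"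
  shows "char (distr M borel Z) u = (\<integral>\<omega>. iexp (u * Z \<omega>) \<partial>M)"
  unfolding char_def by (subst integral_distr) auto

lemma centered_normal_cong_AE:
  assumes "centered_normal M v Z" "AE \<omega> in M. Z \<omega> = Y \<omega>" "Y \<in> borel_measurable M"
  shows "centered_normal M v Y"
proof -
  have "distr M borel Z = distr M borel Y"
    by (rule distr_cong_AE) (use assms in \<open>auto simp: centered_normal_def\<close>)
  then show ?thesis using assms by (simp add: centered_normal_def)
qed

lemma centered_normal_0: "centered_normal M 0 (\<lambda>_. 0)"
  unfolding centered_normal_def by (auto simp: char_distr prob_space simp del: distr_const)

lemma centered_normal_scale:
  assumes "centered_normal M v Z"
  shows "centered_normal M (c\<^sup>2 * v) (\<lambda>\<omega>. c * Z \<omega>)"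
proof -
  have Z[measurable]: "Z \<in> borel_measurable M" using assms by (auto simp: centered_normal_def)
  have "char (distr M borel (\<lambda>\<omega>. c * Z \<omega>)) u = char (distr M borel Z) (c * u)" for u
    by (simp add: char_distr ac_simps)
  then show ?thesis using assms by (auto simp: centered_normal_def power_mult_distrib ac_simps)
qed

lemma centered_normal_distributed:
  assumes "distributed M lborel Z (normal_density 0 \<sigma>)" "0 < \<sigma>"
  shows "centered_normal M (\<sigma>\<^sup>2) Z"
proof -
  have Z[measurable]: "Z \<in> borel_measurable M"
    using distributed_measurable[OF assms(1)] by simp
  have "distributed M lborel (\<lambda>\<omega>. Z \<omega> / \<sigma>) std_normal_density"
    using assms normal_standard_normal_convert[of \<sigma> Z 0] by simp
  from distributed_distr_eq_density[OF this]
  have "distr M borel (\<lambda>\<omega>. Z \<omega> / \<sigma>) = std_normal_distribution"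
    by (simp cong: distr_cong)
  then have "centered_normal M 1 (\<lambda>\<omega>. Z \<omega> / \<sigma>)"
    by (auto simp: centered_normal_def char_std_normal_distribution)
  from centered_normal_scale[OF this, of \<sigma>] show ?thesis using assms by simp
qed

lemma centered_normal_add:
  assumes "centered_normal M v Y" "centered_normal M w Z" "indep_var borel Y borel Z"
  shows "centered_normal M (v + w) (\<lambda>\<omega>. Y \<omega> + Z \<omega>)"
  using assms by (auto simp: centered_normal_def char_distr_add ring_distribs add_divide_distrib
      simp flip: of_real_mult exp_add)

text \<open>Dominated convergence carries the almost sure limit over to the characteristic
  functions, so only convergence of the variances remains. It is read off at one nonzero argument
  \<open>a\<close> at which the limit is positive.\<close>

lemma centered_normal_AE_limit:
  assumes Z: "\<And>n. centered_normal M (v n) (Z n)" and [measurable]: "Y \<in> borel_measurable M"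
    and lim: "AE \<omega> in M. (\<lambda>n. Z n \<omega>) \<longlonglongrightarrow> Y \<omega>"
  shows "\<exists>w. centered_normal M w Y"
proof -
  have [measurable]: "Z n \<in> borel_measurable M" for n
    using Z[of n] by (auto simp: centered_normal_def)
  have v: "0 \<le> v n" for n using Z[of n] by (auto simp: centered_normal_def)
  have conv: "(\<lambda>n. char (distr M borel (Z n)) u) \<longlonglongrightarrow> char (distr M borel Y) u" for u
    unfolding char_distr[OF \<open>Y \<in> borel_measurable M\<close>] char_distr[OF \<open>Z _ \<in> borel_measurable M\<close>]
  proof (rule integral_dominated_convergence[where w="\<lambda>_. 1"])
    show "AE x in M. (\<lambda>n. iexp (u * Z n x)) \<longlonglongrightarrow> iexp (u * Y x)"
      using lim by eventually_elim (intro tendsto_intros)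
  qed auto
  interpret D: real_distribution "distr M borel Y" by (rule real_distribution_distr) simp
  define L where "L u = Re (char (distr M borel Y) u)" for u
  have convR: "(\<lambda>n. exp (- (v n * u\<^sup>2) / 2)) \<longlonglongrightarrow> L u" for u
    using tendsto_Re[OF conv[of u]] Z unfolding L_def by (simp add: centered_normal_def)
  \<comment> \<open>The limit is a characteristic function, hence continuous at 0 with value 1.
    Positivity nearby rules out variances that escape to infinity and permits the logarithm.\<close>
  have "isCont (\<lambda>u. L u) 0" unfolding L_def by (rule continuous_Re) (rule D.isCont_char)
  moreover have "L 0 = 1" by (simp add: L_def D.char_zero)
  ultimately have "L \<midarrow>0\<rightarrow> 1" by (simp add: isCont_def)
  then have "eventually (\<lambda>u. L u > 0) (at 0)" by (rule order_tendstoD) simp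
  then obtain d where "d > 0" and d: "\<And>u. u \<noteq> 0 \<Longrightarrow> \<bar>u\<bar> < d \<Longrightarrow> L u > 0"
    by (auto simp: eventually_at dist_real_def)
  define a where "a = d / 2"
  have a: "a > 0" "L a > 0" using \<open>d > 0\<close> d[of a] by (auto simp: a_def)
  have "(\<lambda>n. ln (exp (- (v n * a\<^sup>2) / 2))) \<longlonglongrightarrow> ln (L a)"
    using convR a by (intro tendsto_ln) auto
  then have "(\<lambda>n. (- 2 / a\<^sup>2) * (- (v n * a\<^sup>2) / 2)) \<longlonglongrightarrow> (- 2 / a\<^sup>2) * ln (L a)"
    by (intro tendsto_mult tendsto_const) simp
  then have vl: "v \<longlonglongrightarrow> (- 2 / a\<^sup>2) * ln (L a)" (is "_ \<longlonglongrightarrow> ?w") using a by simp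
  have "?w \<ge> 0" using vl v by (intro LIMSEQ_le_const) auto
  moreover have "char (distr M borel Y) u = of_real (exp (- (?w * u\<^sup>2) / 2))" for u
  proof (rule LIMSEQ_unique[OF conv])
    have "(\<lambda>n. complex_of_real (exp (- (v n * u\<^sup>2) / 2))) \<longlonglongrightarrow> of_real (exp (- (?w * u\<^sup>2) / 2))"
      using vl by (intro tendsto_intros) auto
    then show "(\<lambda>n. char (distr M borel (Z n)) u) \<longlonglongrightarrow> of_real (exp (- (?w * u\<^sup>2) / 2))"
      using Z by (simp add: centered_normal_def)
  qed
  ultimately show ?thesis by (intro exI[of _ ?w]) (simp add: centered_normal_def)
qed

text \<open>Both sides have the same characteristic function, so Levy's uniqueness theorem applies.
  The degenerate case needs \<open>return\<close>, since a normal density with standard deviation 0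
  is no probability density.\<close>

lemma centered_normal_distr:
  assumes "centered_normal M v Z"
  shows "distr M borel Z =
    (if v = 0 then return borel 0 else density lborel (normal_density 0 (sqrt v)))"
proof (cases "v = 0")
  case True
  have [measurable]: "Z \<in> borel_measurable M" using assms by (simp add: centered_normal_def)
  have "real_distribution (return borel (0::real))"
    by (simp add: real_distribution_def real_distribution_axioms_def prob_space_return)
  moreover have "char (return borel (0::real)) = (\<lambda>_. 1)"
    by (simp add: char_def fun_eq_iff integral_return)
  ultimately show ?thesis
    using assms True
    by (auto intro!: Levy_uniqueness real_distribution_distr simp: centered_normal_def)
next
  case False
  have Z[measurable]: "Z \<in> borel_measurable M" using assms by (simp add: centered_normal_def)
  have "v > 0" using False assms by (simp add: centered_normal_def)
  define N where "N = density lborel (normal_density 0 (sqrt v))"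
  have "prob_space N" unfolding N_def by (rule prob_space_normal_density) (simp add: \<open>v > 0\<close>)
  then interpret N: prob_space N .
  have rN: "real_distribution N"
    unfolding real_distribution_def real_distribution_axioms_def
    using N.prob_space_axioms by (simp add: N_def)
  \<comment> \<open>The identity, viewed as a random variable on \<open>N\<close> itself, has the
    density in question; \<open>centered_normal_distributed\<close> then yields the characteristic
    function of \<open>N\<close>.\<close>
  have "distr N lborel (\<lambda>x. x) = N"
    by (rule measure_eqI) (auto simp: N_def emeasure_distr)
  then have "distributed N lborel (\<lambda>x. x) (normal_density 0 (sqrt v))"
    unfolding distributed_def by (auto simp: N_def)
  from N.centered_normal_distributed[OF this] \<open>v > 0\<close>
  have "centered_normal N v (\<lambda>x. x)" by simp
  moreover have "distr N borel (\<lambda>x. x) = N"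
    by (rule measure_eqI) (auto simp: N_def emeasure_distr)
  ultimately have "char N = (\<lambda>u. of_real (exp (- (v * u\<^sup>2) / 2)))"
    by (auto simp: centered_normal_def fun_eq_iff)
  then have "distr M borel Z = N"
    using assms rN by (intro Levy_uniqueness real_distribution_distr) (auto simp: centered_normal_def)
  then show ?thesis using False by (simp add: N_def)
qed

lemma centered_normal_gaussian_rv:
  assumes "centered_normal M v Z"
  shows "gaussian_rv M Z"
  unfolding gaussian_rv_def
  using assms centered_normal_distr[OF assms]
  by (intro conjI exI[of _ 0] exI[of _ "sqrt v"]) (auto simp: centered_normal_def)

lemma centered_normal_expectation:
  assumes "centered_normal M v Z"
  shows "expectation Z = 0"
proof -
  have [measurable]: "Z \<in> borel_measurable M" using assms by (simp add: centered_normal_def)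
  have "v \<ge> 0" using assms by (simp add: centered_normal_def)
  have "expectation Z = (\<integral>x. x \<partial>distr M borel Z)"
    by (subst integral_distr) auto
  also have "\<dots> = 0"
  proof (cases "v = 0")
    case True
    then show ?thesis by (simp add: centered_normal_distr[OF assms] integral_return)
  next
    case False
    then have "v > 0" using \<open>v \<ge> 0\<close> by simp
    then show ?thesis
      using integral_normal_moment_odd[of "sqrt v" 0 0]
      by (simp add: centered_normal_distr[OF assms] integral_density)
  qed
  finally show ?thesis .
qed

end

section \<open>The Gaussian space of a Brownian motion\<close>

lemma partition_of_mono:
  assumes "partition_of t n \<tau>" "i \<le> j" "j \<le> n"
  shows "\<tau> i \<le> \<tau> j"
  using assms(2,3)
proof (induction j rule: dec_induct)
  case (step j)
  then have "\<tau> j \<le> \<tau> (Suc j)" using assms(1) by (simp add: partition_of_def)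
  with step show ?case by simp
qed simp

lemma partition_of_nonneg:
  assumes "partition_of t n \<tau>" "i \<le> n"
  shows "0 \<le> \<tau> i"
  using partition_of_mono[OF assms(1), of 0 i] assms by (simp add: partition_of_def)

lemma partition_of_le:
  assumes "partition_of t n \<tau>" "i \<le> n"
  shows "\<tau> i \<le> t"
  using partition_of_mono[OF assms(1), of i n] assms by (simp add: partition_of_def)

lemma step_fun_outside:
  assumes "partition_of t n \<tau>" "s \<notin> {0..t}"
  shows "step_fun n \<tau> c s = 0"
  unfolding step_fun_def
proof (rule sum.neutral, rule ballI)
  fix i assume "i \<in> {..<n}"
  then have "0 \<le> \<tau> i" "\<tau> (Suc i) \<le> t"
    using partition_of_nonneg[OF assms(1), of i] partition_of_le[OF assms(1), of "Suc i"] by auto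
  then show "c i * indicator {\<tau> i<..\<tau> (Suc i)} s = 0"
    using assms(2) by (auto simp: indicator_def)
qed

lemma step_fun_measurable [measurable]: "step_fun n \<tau> c \<in> borel_measurable borel"
  unfolding step_fun_def by measurable

text \<open>The pointwise inequality is \<open>0 \<le> (f x - 2 * g x + h x)\<^sup>2\<close>
  rearranged. It serves as a triangle inequality that avoids square roots in
  \<open>ennreal\<close>.\<close>

lemma nn_integral_square_diff_triangle:
  fixes f g h :: "'a \<Rightarrow> real"
  assumes [measurable]: "f \<in> borel_measurable M" "g \<in> borel_measurable M" "h \<in> borel_measurable M"
  shows "(\<integral>\<^sup>+x. ennreal ((f x - h x)\<^sup>2) \<partial>M) \<le>
    2 * (\<integral>\<^sup>+x. ennreal ((f x - g x)\<^sup>2) \<partial>M) + 2 * (\<integral>\<^sup>+x. ennreal ((g x - h x)\<^sup>2) \<partial>M)"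
proof -
  have "(f x - h x)\<^sup>2 \<le> 2 * (f x - g x)\<^sup>2 + 2 * (g x - h x)\<^sup>2" for x
    using zero_le_power2[of "f x - 2 * g x + h x"] by (simp add: power2_eq_square algebra_simps)
  then have "(\<integral>\<^sup>+x. ennreal ((f x - h x)\<^sup>2) \<partial>M) \<le>
    (\<integral>\<^sup>+x. ennreal (2 * (f x - g x)\<^sup>2 + 2 * (g x - h x)\<^sup>2) \<partial>M)"
    by (intro nn_integral_mono ennreal_leI)
  also have "\<dots> = (\<integral>\<^sup>+x. 2 * ennreal ((f x - g x)\<^sup>2) + 2 * ennreal ((g x - h x)\<^sup>2) \<partial>M)"
    by (intro nn_integral_cong) (simp add: ennreal_mult)
  also have "\<dots> = 2 * (\<integral>\<^sup>+x. ennreal ((f x - g x)\<^sup>2) \<partial>M) + 2 * (\<integral>\<^sup>+x. ennreal ((g x - h x)\<^sup>2) \<partial>M)"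
    by (simp add: nn_integral_add nn_integral_cmult)
  finally show ?thesis .
qed

text \<open>A set of times, rather than a list, keeps the times distinct and allows induction on the
  largest one.\<close>

definition brownian_span :: "(real \<Rightarrow> 'a \<Rightarrow> real) \<Rightarrow> ('a \<Rightarrow> real) set" where
  "brownian_span W =
     {Z. \<exists>T d. finite T \<and> T \<subseteq> {0..} \<and> Z = (\<lambda>\<omega>. \<Sum>t\<in>T. d t * W t \<omega>)}"

lemma brownian_span_base: "0 \<le> t \<Longrightarrow> W t \<in> brownian_span W"
  unfolding brownian_span_def by (auto intro!: exI[of _ "{t}"] exI[of _ "\<lambda>_. 1"])

lemma brownian_span_0: "(\<lambda>_. 0) \<in> brownian_span W"
  unfolding brownian_span_def by (auto intro!: exI[of _ "{}"])

lemma brownian_span_scale: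
  assumes "Z \<in> brownian_span W"
  shows "(\<lambda>\<omega>. c * Z \<omega>) \<in> brownian_span W"
proof -
  obtain T d where "finite T" "T \<subseteq> {0..}" "Z = (\<lambda>\<omega>. \<Sum>t\<in>T. d t * W t \<omega>)"
    using assms by (auto simp: brownian_span_def)
  then show ?thesis unfolding brownian_span_def
    by (auto intro!: exI[of _ T] exI[of _ "\<lambda>t. c * d t"] simp: sum_distrib_left mult.assoc)
qed

lemma brownian_span_add:
  assumes "Y \<in> brownian_span W" "Z \<in> brownian_span W"
  shows "(\<lambda>\<omega>. Y \<omega> + Z \<omega>) \<in> brownian_span W"
proof -
  obtain S c where S: "finite S" "S \<subseteq> {0..}" "Y = (\<lambda>\<omega>. \<Sum>t\<in>S. c t * W t \<omega>)"
    using assms by (auto simp: brownian_span_def)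
  obtain T d where T: "finite T" "T \<subseteq> {0..}" "Z = (\<lambda>\<omega>. \<Sum>t\<in>T. d t * W t \<omega>)"
    using assms by (auto simp: brownian_span_def)
  define c' where "c' t = (if t \<in> S then c t else 0)" for t
  define d' where "d' t = (if t \<in> T then d t else 0)" for t
  have "(\<Sum>t\<in>S. c t * W t \<omega>) = (\<Sum>t\<in>S \<union> T. c' t * W t \<omega>)" for \<omega>
    by (rule sum.mono_neutral_cong_left) (use S T in \<open>auto simp: c'_def\<close>)
  moreover have "(\<Sum>t\<in>T. d t * W t \<omega>) = (\<Sum>t\<in>S \<union> T. d' t * W t \<omega>)" for \<omega>
    by (rule sum.mono_neutral_cong_left) (use S T in \<open>auto simp: d'_def\<close>)
  ultimately have "(\<lambda>\<omega>. Y \<omega> + Z \<omega>) = (\<lambda>\<omega>. \<Sum>t\<in>S \<union> T. (c' t + d' t) * W t \<omega>)"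
    by (simp add: S T sum.distrib ring_distribs)
  then show ?thesis unfolding brownian_span_def using S T
    by (auto intro!: exI[of _ "S \<union> T"] exI[of _ "\<lambda>t. c' t + d' t"])
qed

lemma brownian_span_sum:
  "finite I \<Longrightarrow> (\<And>i. i \<in> I \<Longrightarrow> Z i \<in> brownian_span W) \<Longrightarrow>
    (\<lambda>\<omega>. \<Sum>i\<in>I. Z i \<omega>) \<in> brownian_span W"
  by (induction I rule: finite_induct) (auto intro: brownian_span_0 brownian_span_add)

lemma step_integral_brownian_span:
  assumes "partition_of t n \<tau>"
  shows "step_integral W n \<tau> c \<in> brownian_span W"
proof -
  have "(\<lambda>\<omega>. c i * (W (\<tau> (Suc i)) \<omega> + (- 1) * W (\<tau> i) \<omega>)) \<in> brownian_span W" if "i < n" for i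
    using that partition_of_nonneg[OF assms, of i] partition_of_nonneg[OF assms, of "Suc i"]
    by (intro brownian_span_scale brownian_span_add brownian_span_base) auto
  then have "(\<lambda>\<omega>. \<Sum>i<n. c i * (W (\<tau> (Suc i)) \<omega> + (- 1) * W (\<tau> i) \<omega>)) \<in> brownian_span W"
    by (intro brownian_span_sum) auto
  then show ?thesis by (simp add: step_integral_def[abs_def])
qed

text \<open>Contains all the Wiener integrals when \<open>S\<close> is the span of the values of
  \<open>W\<close>. Sequences are used because normality passes to the limit along an almost surely
  convergent subsequence.\<close>

definition L2_closure :: "'a measure \<Rightarrow> ('a \<Rightarrow> real) set \<Rightarrow> ('a \<Rightarrow> real) set" where
  "L2_closure M S = {Y \<in> borel_measurable M. \<exists>Z. (\<forall>n::nat. Z n \<in> S) \<and>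
     (\<lambda>n. \<integral>\<^sup>+\<omega>. ennreal ((Y \<omega> - Z n \<omega>)\<^sup>2) \<partial>M) \<longlonglongrightarrow> 0}"

lemma L2_closure_superset:
  assumes "Y \<in> S" "Y \<in> borel_measurable M"
  shows "Y \<in> L2_closure M S"
  using assms unfolding L2_closure_def by (auto intro!: exI[of _ "\<lambda>_. Y"])

text \<open>Serves the time \<infinity>, where the process is prescribed on \<open>space M\<close>
  only.\<close>

lemma L2_closure_cong:
  assumes "Y \<in> L2_closure M S" "\<And>\<omega>. \<omega> \<in> space M \<Longrightarrow> Y \<omega> = Y' \<omega>"
  shows "Y' \<in> L2_closure M S"
proof -
  have "(\<integral>\<^sup>+\<omega>. ennreal ((Y \<omega> - Z \<omega>)\<^sup>2) \<partial>M) = (\<integral>\<^sup>+\<omega>. ennreal ((Y' \<omega> - Z \<omega>)\<^sup>2) \<partial>M)" for Z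
    by (rule nn_integral_cong) (simp add: assms(2))
  moreover have "Y' \<in> borel_measurable M \<longleftrightarrow> Y \<in> borel_measurable M"
    by (rule measurable_cong) (simp add: assms(2))
  ultimately show ?thesis using assms(1) unfolding L2_closure_def by simp
qed

lemma L2_closure_scale:
  assumes "Y \<in> L2_closure M S" and S: "\<And>Z. Z \<in> S \<Longrightarrow> (\<lambda>\<omega>. c * Z \<omega>) \<in> S" "S \<subseteq> borel_measurable M"
  shows "(\<lambda>\<omega>. c * Y \<omega>) \<in> L2_closure M S"
proof -
  obtain Z where Z: "\<And>n. Z n \<in> S" "(\<lambda>n. \<integral>\<^sup>+\<omega>. ennreal ((Y \<omega> - Z n \<omega>)\<^sup>2) \<partial>M) \<longlonglongrightarrow> 0"
    and [measurable]: "Y \<in> borel_measurable M"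
    using assms(1) by (auto simp: L2_closure_def)
  have [measurable]: "Z n \<in> borel_measurable M" for n using Z(1) S(2) by auto
  have "(c * Y \<omega> - c * Z n \<omega>)\<^sup>2 = c\<^sup>2 * (Y \<omega> - Z n \<omega>)\<^sup>2" for n \<omega>
    by (simp add: power2_eq_square algebra_simps)
  then have "(\<integral>\<^sup>+\<omega>. ennreal ((c * Y \<omega> - c * Z n \<omega>)\<^sup>2) \<partial>M) =
      ennreal (c\<^sup>2) * (\<integral>\<^sup>+\<omega>. ennreal ((Y \<omega> - Z n \<omega>)\<^sup>2) \<partial>M)" for n
    by (simp add: ennreal_mult nn_integral_cmult)
  moreover have "(\<lambda>n. ennreal (c\<^sup>2) * (\<integral>\<^sup>+\<omega>. ennreal ((Y \<omega> - Z n \<omega>)\<^sup>2) \<partial>M)) \<longlonglongrightarrow> ennreal (c\<^sup>2) * 0"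
    by (intro ennreal_tendsto_cmult Z(2)) auto
  ultimately show ?thesis
    using Z(1) S(1) unfolding L2_closure_def by (auto intro!: exI[of _ "\<lambda>n \<omega>. c * Z n \<omega>"])
qed

lemma tendsto_upperbound_zero_ennreal:
  fixes f g :: "nat \<Rightarrow> ennreal"
  assumes "g \<longlonglongrightarrow> 0" "\<And>n. f n \<le> g n"
  shows "f \<longlonglongrightarrow> 0"
  by (rule tendsto_sandwich[OF _ _ tendsto_const assms(1)]) (simp_all add: assms(2))

lemma L2_closure_add:
  assumes "X \<in> L2_closure M S" "Y \<in> L2_closure M S"
    and S: "\<And>Y Z. Y \<in> S \<Longrightarrow> Z \<in> S \<Longrightarrow> (\<lambda>\<omega>. Y \<omega> + Z \<omega>) \<in> S" "S \<subseteq> borel_measurable M"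
  shows "(\<lambda>\<omega>. X \<omega> + Y \<omega>) \<in> L2_closure M S"
proof -
  obtain U where U: "\<And>n. U n \<in> S" "(\<lambda>n. \<integral>\<^sup>+\<omega>. ennreal ((X \<omega> - U n \<omega>)\<^sup>2) \<partial>M) \<longlonglongrightarrow> 0"
    and [measurable]: "X \<in> borel_measurable M"
    using assms(1) by (auto simp: L2_closure_def)
  obtain Z where Z: "\<And>n. Z n \<in> S" "(\<lambda>n. \<integral>\<^sup>+\<omega>. ennreal ((Y \<omega> - Z n \<omega>)\<^sup>2) \<partial>M) \<longlonglongrightarrow> 0"
    and [measurable]: "Y \<in> borel_measurable M"
    using assms(2) by (auto simp: L2_closure_def)
  have [measurable]: "Z n \<in> borel_measurable M" "U n \<in> borel_measurable M" for n
    using Z(1) U(1) S(2) by auto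
  have le: "(\<integral>\<^sup>+\<omega>. ennreal ((X \<omega> + Y \<omega> - (U n \<omega> + Z n \<omega>))\<^sup>2) \<partial>M) \<le>
      2 * (\<integral>\<^sup>+\<omega>. ennreal ((X \<omega> - U n \<omega>)\<^sup>2) \<partial>M) + 2 * (\<integral>\<^sup>+\<omega>. ennreal ((Y \<omega> - Z n \<omega>)\<^sup>2) \<partial>M)" for n
    using nn_integral_square_diff_triangle[of "\<lambda>\<omega>. X \<omega> + Y \<omega>" M "\<lambda>\<omega>. U n \<omega> + Y \<omega>" "\<lambda>\<omega>. U n \<omega> + Z n \<omega>"]
    by simp
  have "(\<lambda>n. 2 * (\<integral>\<^sup>+\<omega>. ennreal ((X \<omega> - U n \<omega>)\<^sup>2) \<partial>M) +
      2 * (\<integral>\<^sup>+\<omega>. ennreal ((Y \<omega> - Z n \<omega>)\<^sup>2) \<partial>M)) \<longlonglongrightarrow> 2 * 0 + 2 * 0"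
    by (intro tendsto_add ennreal_tendsto_cmult U(2) Z(2)) auto
  then have "(\<lambda>n. \<integral>\<^sup>+\<omega>. ennreal ((X \<omega> + Y \<omega> - (U n \<omega> + Z n \<omega>))\<^sup>2) \<partial>M) \<longlonglongrightarrow> 0"
    using le by (simp add: tendsto_upperbound_zero_ennreal)
  then show ?thesis
    using U(1) Z(1) S(1) unfolding L2_closure_def by (auto intro!: exI[of _ "\<lambda>n \<omega>. U n \<omega> + Z n \<omega>"])
qed

section \<open>Normality on the Gaussian space\<close>

context standard_brownian_motion
begin

lemma brownian_measurable: "0 \<le> t \<Longrightarrow> W t \<in> borel_measurable M"
  using measurable_from_subalg[OF subalgebra_filtration adapted] .

lemma brownian_measurable_later: "0 \<le> s \<Longrightarrow> s \<le> t \<Longrightarrow> W s \<in> borel_measurable (F t)"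
proof -
  assume "0 \<le> s" "s \<le> t"
  then have "subalgebra (F t) (F s)"
    using subalgebra_filtration[of s] subalgebra_filtration[of t] filtration_mono[of s t]
    by (auto simp: subalgebra_def)
  then show ?thesis using adapted[OF \<open>0 \<le> s\<close>] by (rule measurable_from_subalg)
qed

text \<open>The sigma-algebra generated by \<open>Z\<close> lies in \<open>F s\<close>, which is
  independent of the increment after \<open>s\<close>; the factor \<open>c\<close> comes in by
  composition.\<close>

lemma increment_indep_var:
  assumes "0 \<le> s" "s < t" "Z \<in> borel_measurable (F s)"
  shows "indep_var borel Z borel (\<lambda>\<omega>. c * (W t \<omega> - W s \<omega>))"
proof -
  have [measurable]: "W t \<in> borel_measurable M" "W s \<in> borel_measurable M"
    using assms brownian_measurable by auto
  have Z[measurable]: "Z \<in> borel_measurable M"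
    using measurable_from_subalg[OF subalgebra_filtration assms(3)] assms(1) by simp
  have sp: "space (F s) = space M" using subalgebra_filtration[OF assms(1)] by (simp add: subalgebra_def)
  let ?D = "\<lambda>\<omega>. W t \<omega> - W s \<omega>"
  have "indep_set (sigma_sets (space M) {Z -` A \<inter> space M |A. A \<in> sets borel})
      (sigma_sets (space M) {?D -` A \<inter> space M |A. A \<in> sets borel})"
    unfolding indep_set_def
  proof (rule indep_sets_mono_sets)
    show "indep_sets (case_bool (sets (F s)) (sets (vimage_algebra (space M) ?D borel))) UNIV"
      using increment_indep[OF assms(1,2)] by (simp add: indep_set_def)
    have "sigma_sets (space M) {Z -` A \<inter> space M |A. A \<in> sets borel} \<subseteq> sets (F s)"
      unfolding sp[symmetric]
      by (rule sets.sigma_sets_subset) (use measurable_sets[OF assms(3)] in auto)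
    then show "case_bool (sigma_sets (space M) {Z -` A \<inter> space M |A. A \<in> sets borel})
      (sigma_sets (space M) {?D -` A \<inter> space M |A. A \<in> sets borel}) i
      \<subseteq> case_bool (sets (F s)) (sets (vimage_algebra (space M) ?D borel)) i" for i
      by (auto split: bool.split simp: sets_vimage_algebra)
  qed
  then have "indep_var borel Z borel ?D" by (simp add: indep_var_eq)
  from indep_var_compose[OF this, of "\<lambda>x. x" borel "\<lambda>x. c * x" borel] show ?thesis
    by (simp add: comp_def)
qed

text \<open>Induction on the largest time \<open>b\<close>. With \<open>s\<close> the largest of the
  other times, \<open>W b = W s + (W b - W s)\<close>: the first summand joins the combination over
  the earlier times, the second is an independent normal increment. Inserting 0 guarantees that a
  positive \<open>b\<close> has an earlier time.\<close>

lemma centered_normal_combination: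
  assumes "finite T" "T \<subseteq> {0..}"
  shows "\<exists>v. centered_normal M v (\<lambda>\<omega>. \<Sum>t\<in>insert 0 T. d t * W t \<omega>)"
  using assms
proof (induction T arbitrary: d rule: finite_linorder_max_induct)
  case empty
  have [measurable]: "W 0 \<in> borel_measurable M" by (simp add: brownian_measurable)
  have "centered_normal M 0 (\<lambda>\<omega>. \<Sum>t\<in>insert 0 {}. d t * W t \<omega>)"
    by (rule centered_normal_cong_AE[OF centered_normal_0]) (use start_zero in auto)
  then show ?case by blast
next
  case (insert b T)
  show ?case
  proof (cases "b = 0")
    case True
    then have "T = {}" using insert by force
    then show ?thesis using insert.IH[of d] True by simp
  next
    case False
    then have "b > 0" using insert by auto
    define s where "s = Max (insert 0 T)"
    have s_in: "s \<in> insert 0 T" unfolding s_def by (rule Max_in) (use insert in auto)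
    have s: "0 \<le> s" "s < b" using insert s_in \<open>b > 0\<close> by auto
    have le: "t \<le> s" if "t \<in> insert 0 T" for t unfolding s_def by (rule Max_ge) (use insert that in auto)
    have nn: "0 \<le> t" if "t \<in> insert 0 T" for t using insert that by auto
    \<comment> \<open>The weight of \<open>b\<close> moves to \<open>s\<close>.\<close>
    define d' where "d' = d(s := d s + d b)"
    define Z where "Z = (\<lambda>\<omega>. \<Sum>t\<in>insert 0 T. d' t * W t \<omega>)"
    obtain v where v: "centered_normal M v Z" using insert.IH[of d'] insert.prems Z_def by auto
    have "Z \<in> borel_measurable (F s)" unfolding Z_def
      by (intro borel_measurable_sum borel_measurable_times borel_measurable_const
          brownian_measurable_later nn le)
    then have ind: "indep_var borel Z borel (\<lambda>\<omega>. d b * (W b \<omega> - W s \<omega>))"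
      using s by (intro increment_indep_var)
    have "centered_normal M ((sqrt (b - s))\<^sup>2) (\<lambda>\<omega>. W b \<omega> - W s \<omega>)"
      using s by (intro centered_normal_distributed increment_normal) auto
    from centered_normal_add[OF v centered_normal_scale[OF this] ind]
    have ex: "\<exists>v. centered_normal M v (\<lambda>\<omega>. Z \<omega> + d b * (W b \<omega> - W s \<omega>))" by blast
    have b: "b \<notin> insert 0 T" using insert \<open>b > 0\<close> by auto
    have fin: "finite (insert 0 T)" using insert by simp
    have "(\<Sum>t\<in>insert 0 (insert b T). d t * W t \<omega>) = Z \<omega> + d b * (W b \<omega> - W s \<omega>)" for \<omega>
    proof -
      have "Z \<omega> = (\<Sum>t\<in>insert 0 T. d t * W t \<omega> + (if t = s then d b * W s \<omega> else 0))"
        unfolding Z_def by (rule sum.cong) (auto simp: d'_def ring_distribs)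
      also have "\<dots> = (\<Sum>t\<in>insert 0 T. d t * W t \<omega>) + d b * W s \<omega>"
        unfolding sum.distrib using fin s_in by (subst sum.delta) auto
      finally have "Z \<omega> = (\<Sum>t\<in>insert 0 T. d t * W t \<omega>) + d b * W s \<omega>" .
      moreover have "(\<Sum>t\<in>insert 0 (insert b T). d t * W t \<omega>) =
          d b * W b \<omega> + (\<Sum>t\<in>insert 0 T. d t * W t \<omega>)"
        using sum.insert[OF fin b] by (simp add: insert_commute)
      ultimately show ?thesis by (simp add: algebra_simps)
    qed
    with ex show ?thesis by simp
  qed
qed

lemma brownian_span_centered_normal:
  assumes "Z \<in> brownian_span W"
  shows "\<exists>v. centered_normal M v Z"
proof -
  obtain T d where T: "finite T" "T \<subseteq> {0..}" "Z = (\<lambda>\<omega>. \<Sum>t\<in>T. d t * W t \<omega>)"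
    using assms by (auto simp: brownian_span_def)
  \<comment> \<open>Time 0 enters with coefficient 0 unless it is one of the times already.\<close>
  have Z: "Z = (\<lambda>\<omega>. \<Sum>t\<in>insert 0 T. (if t \<in> T then d t else 0) * W t \<omega>)"
    unfolding T(3) by (intro ext sum.mono_neutral_cong_left) (use T in auto)
  show ?thesis unfolding Z by (rule centered_normal_combination[OF T(1,2)])
qed

lemma brownian_span_measurable: "brownian_span W \<subseteq> borel_measurable M"
proof
  fix Z assume "Z \<in> brownian_span W"
  from brownian_span_centered_normal[OF this] show "Z \<in> borel_measurable M"
    by (auto simp: centered_normal_def)
qed

lemma L2_closure_brownian_span_centered_normal:
  assumes "Y \<in> L2_closure M (brownian_span W)"
  shows "\<exists>v. centered_normal M v Y"
proof -
  obtain Z where Z: "\<And>n. Z n \<in> brownian_span W"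
      "(\<lambda>n. \<integral>\<^sup>+\<omega>. ennreal ((Y \<omega> - Z n \<omega>)\<^sup>2) \<partial>M) \<longlonglongrightarrow> 0"
    and Y: "Y \<in> borel_measurable M"
    using assms by (auto simp: L2_closure_def)
  have "Z n \<in> borel_measurable M" for n using Z(1) brownian_span_measurable by auto
  from L2_limit_AE_subseq[OF this Y Z(2)] obtain r :: "nat \<Rightarrow> nat"
    where r: "AE \<omega> in M. (\<lambda>n. Z (r n) \<omega>) \<longlonglongrightarrow> Y \<omega>" by auto
  have "\<forall>n. \<exists>v. centered_normal M v (Z (r n))"
    using brownian_span_centered_normal[OF Z(1)] by blast
  then obtain v where "\<And>n. centered_normal M (v n) (Z (r n))" by metis
  from centered_normal_AE_limit[OF this Y r] show ?thesis .
qed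

lemma wiener_integral_L2_closure:
  assumes "is_wiener_integral M W t f Y"
  shows "Y \<in> L2_closure M (brownian_span W)"
proof -
  obtain n \<tau> c where "\<And>k. partition_of t (n k) (\<tau> k)"
    and "(\<lambda>k. \<integral>\<^sup>+\<omega>. ennreal ((Y \<omega> - step_integral W (n k) (\<tau> k) (c k) \<omega>)\<^sup>2) \<partial>M) \<longlonglongrightarrow> 0"
    and "Y \<in> borel_measurable M"
    using assms unfolding is_wiener_integral_def by auto
  then show ?thesis
    unfolding L2_closure_def
    by (auto intro!: step_integral_brownian_span exI[of _ "\<lambda>k. step_integral W (n k) (\<tau> k) (c k)"])
qed

lemma L2_closure_brownian_span_combination:
  assumes "finite J" "\<And>i. i \<in> J \<Longrightarrow> X i \<in> L2_closure M (brownian_span W)"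
  shows "(\<lambda>\<omega>. \<Sum>i\<in>J. c i * X i \<omega>) \<in> L2_closure M (brownian_span W)"
  using assms
proof (induction J rule: finite_induct)
  case empty
  show ?case by (simp add: L2_closure_superset brownian_span_0)
next
  case (insert i J)
  have "(\<lambda>\<omega>. c i * X i \<omega> + (\<Sum>i\<in>J. c i * X i \<omega>)) \<in> L2_closure M (brownian_span W)"
    using insert
    by (intro L2_closure_add L2_closure_scale brownian_span_scale brownian_span_add
        brownian_span_measurable) auto
  then show ?case using insert by simp
qed

end

section \<open>The Ito isometry for step functions\<close>

text \<open>For intervals starting at 0 the overlap has length \<open>min x y\<close>; the general
  case expands \<open>{a<..b}\<close> bilinearly as the difference of \<open>{0<..b}\<close> and
  \<open>{0<..a}\<close>. The unsimplified value agrees term by term with the covariance of two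
  Brownian increments.\<close>

lemma has_bochner_integral_indicator_product:
  fixes a b c d :: real
  assumes "0 \<le> a" "a \<le> b" "0 \<le> c" "c \<le> d"
  shows "has_bochner_integral lborel (\<lambda>s. indicator {a<..b} s * indicator {c<..d} s :: real)
    (min b d - min b c - min a d + min a c)"
proof -
  have base: "has_bochner_integral lborel (\<lambda>s. indicator {0<..x} s * indicator {0<..y} s :: real) (min x y)"
    if "0 \<le> x" "0 \<le> y" for x y :: real
  proof -
    have "has_bochner_integral lborel (indicator {0<..min x y} :: real \<Rightarrow> real) (measure lborel {0<..min x y})"
      using that by (intro has_bochner_integral_real_indicator) auto
    moreover have "(indicator {0<..min x y} :: real \<Rightarrow> real) = (\<lambda>s. indicator {0<..x} s * indicator {0<..y} s)"
      by (auto simp: indicator_def fun_eq_iff)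
    ultimately show ?thesis using that by simp
  qed
  have "has_bochner_integral lborel (\<lambda>s. indicator {0<..b} s * indicator {0<..d} s
      - indicator {0<..b} s * indicator {0<..c} s - indicator {0<..a} s * indicator {0<..d} s
      + indicator {0<..a} s * indicator {0<..c} s :: real) (min b d - min b c - min a d + min a c)"
    using assms by (intro has_bochner_integral_add has_bochner_integral_diff base) auto
  moreover have "(\<lambda>s. indicator {0<..b} s * indicator {0<..d} s
      - indicator {0<..b} s * indicator {0<..c} s - indicator {0<..a} s * indicator {0<..d} s
      + indicator {0<..a} s * indicator {0<..c} s) = (\<lambda>s. indicator {a<..b} s * indicator {c<..d} s :: real)"
    using assms by (auto simp: indicator_def fun_eq_iff)
  ultimately show ?thesis by simp
qed

lemma has_bochner_integral_square_sum:
  fixes g :: "'i \<Rightarrow> 'a \<Rightarrow> real"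
  assumes "\<And>i j. i \<in> S \<Longrightarrow> j \<in> S \<Longrightarrow> has_bochner_integral N (\<lambda>x. g i x * g j x) (k i j)"
  shows "has_bochner_integral N (\<lambda>x. (\<Sum>i\<in>S. c i * g i x)\<^sup>2) (\<Sum>i\<in>S. \<Sum>j\<in>S. c i * c j * k i j)"
proof -
  have "has_bochner_integral N (\<lambda>x. \<Sum>i\<in>S. \<Sum>j\<in>S. c i * c j * (g i x * g j x))
      (\<Sum>i\<in>S. \<Sum>j\<in>S. c i * c j * k i j)"
    by (intro has_bochner_integral_sum has_bochner_integral_mult_right assms)
  then show ?thesis by (simp add: power2_eq_square sum_product ac_simps)
qed

section \<open>Moments and covariances of increments, and the isometry\<close>

context standard_brownian_motion
begin

text \<open>Order 2 leads to the isometry, high orders to the tail estimate on dyadic grids. The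
  moments of the normal density are carried over through the law of the increment.\<close>

lemma increment_even_moment:
  assumes "0 \<le> s" "s < t"
  shows "has_bochner_integral M (\<lambda>\<omega>. (W t \<omega> - W s \<omega>) ^ (2 * k))
    (fact (2 * k) / (2 ^ k * fact k) * (t - s) ^ k)"
proof -
  let ?f = "normal_density 0 (sqrt (t - s))"
  have d: "distributed M lborel (\<lambda>\<omega>. W t \<omega> - W s \<omega>) ?f" using assms by (rule increment_normal)
  have pos: "0 < sqrt (t - s)" using assms by simp
  have val: "has_bochner_integral lborel (\<lambda>x. ?f x * x ^ (2 * k))
      (fact (2 * k) / ((2 / (sqrt (t - s))\<^sup>2) ^ k * fact k))"
    using normal_moment_even[OF pos, of 0 k] by simp
  have eq: "(fact (2 * k) / ((2 / (sqrt (t - s))\<^sup>2) ^ k * fact k)) =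
      fact (2 * k) / (2 ^ k * fact k) * (t - s) ^ k"
    using assms by (simp add: power_divide)
  show ?thesis
    unfolding has_bochner_integral_iff
  proof
    have "integrable lborel (\<lambda>x. ?f x * x ^ (2 * k))"
      using val by (rule integrable.intros)
    then show "integrable M (\<lambda>\<omega>. (W t \<omega> - W s \<omega>) ^ (2 * k))"
      by (subst distributed_integrable[OF d, symmetric]) auto
    have "(\<integral>\<omega>. (W t \<omega> - W s \<omega>) ^ (2 * k) \<partial>M) = (\<integral>x. ?f x * x ^ (2 * k) \<partial>lborel)"
      by (subst distributed_integral[OF d, symmetric]) auto
    then show "(\<integral>\<omega>. (W t \<omega> - W s \<omega>) ^ (2 * k) \<partial>M) = fact (2 * k) / (2 ^ k * fact k) * (t - s) ^ k"
      using has_bochner_integral_integral_eq[OF val] eq by simp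
  qed
qed

lemma increment_variance:
  assumes "0 \<le> s" "0 \<le> t"
  shows "has_bochner_integral M (\<lambda>\<omega>. (W t \<omega> - W s \<omega>)\<^sup>2) \<bar>t - s\<bar>"
proof -
  consider "s < t" | "t < s" | "s = t" by linarith
  then show ?thesis
  proof cases
    case 1
    then show ?thesis using increment_even_moment[OF assms(1) 1, of 1] by simp
  next
    case 2
    then show ?thesis using increment_even_moment[OF assms(2) 2, of 1]
      by (simp add: power2_commute)
  qed (simp add: has_bochner_integral_zero)
qed

text \<open>The covariance comes from the variances of increments by polarisation.\<close>

lemma brownian_covariance:
  assumes "0 \<le> s" "0 \<le> t"
  shows "has_bochner_integral M (\<lambda>\<omega>. W s \<omega> * W t \<omega>) (min s t)"
proof -
  have [measurable]: "W x \<in> borel_measurable M" if "0 \<le> x" for x using brownian_measurable[OF that] .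
  have [measurable]: "W s \<in> borel_measurable M" "W t \<in> borel_measurable M" "W 0 \<in> borel_measurable M"
    using assms by auto
  have sq: "has_bochner_integral M (\<lambda>\<omega>. (W x \<omega>)\<^sup>2) x" if "0 \<le> x" for x
  proof -
    have [measurable]: "W x \<in> borel_measurable M" using that by simp
    have "has_bochner_integral M (\<lambda>\<omega>. (W x \<omega> - W 0 \<omega>)\<^sup>2) x"
      using increment_variance[of 0 x] that by simp
    then show ?thesis
      by (rule has_bochner_integral_cong_AE[THEN iffD1, rotated -1]) (use start_zero in auto)
  qed
  have "has_bochner_integral M (\<lambda>\<omega>. ((W s \<omega>)\<^sup>2 + (W t \<omega>)\<^sup>2 - (W t \<omega> - W s \<omega>)\<^sup>2) * (1 / 2))
      ((s + t - \<bar>t - s\<bar>) * (1 / 2))"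
    using assms by (intro has_bochner_integral_mult_left has_bochner_integral_add
        has_bochner_integral_diff sq increment_variance)
  moreover have "((W s \<omega>)\<^sup>2 + (W t \<omega>)\<^sup>2 - (W t \<omega> - W s \<omega>)\<^sup>2) * (1 / 2) = W s \<omega> * W t \<omega>" for \<omega>
    by (simp add: power2_eq_square algebra_simps)
  moreover have "(s + t - \<bar>t - s\<bar>) * (1 / 2) = min s t" by (simp add: min_def)
  ultimately show ?thesis by simp
qed

lemma increment_covariance:
  assumes "0 \<le> a" "0 \<le> b" "0 \<le> c" "0 \<le> d"
  shows "has_bochner_integral M (\<lambda>\<omega>. (W b \<omega> - W a \<omega>) * (W d \<omega> - W c \<omega>))
    (min b d - min b c - min a d + min a c)"
proof -
  have "has_bochner_integral M (\<lambda>\<omega>. W b \<omega> * W d \<omega> - W b \<omega> * W c \<omega> - W a \<omega> * W d \<omega> + W a \<omega> * W c \<omega>)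
    (min b d - min b c - min a d + min a c)"
    using assms by (intro has_bochner_integral_add has_bochner_integral_diff brownian_covariance)
  then show ?thesis by (simp add: algebra_simps)
qed

text \<open>Both squares expand into the same quadratic form, as the covariance of two increments is
  the length of the overlap of their intervals. The intervals may overlap, so different partitions
  can be combined without a common refinement.\<close>

lemma ito_isometry:
  assumes "\<And>i. i \<in> S \<Longrightarrow> 0 \<le> a i \<and> a i \<le> b i"
  shows "(\<integral>\<^sup>+\<omega>. ennreal ((\<Sum>i\<in>S. c i * (W (b i) \<omega> - W (a i) \<omega>))\<^sup>2) \<partial>M) =
    (\<integral>\<^sup>+s. ennreal ((\<Sum>i\<in>S. c i * indicator {a i<..b i} s)\<^sup>2) \<partial>lborel)"
proof -
  let ?k = "\<lambda>i j. min (b i) (b j) - min (b i) (a j) - min (a i) (b j) + min (a i) (a j)"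
  let ?v = "\<Sum>i\<in>S. \<Sum>j\<in>S. c i * c j * ?k i j"
  have nn: "0 \<le> a i" "0 \<le> b i" "a i \<le> b i" if "i \<in> S" for i using assms[OF that] by auto
  have "has_bochner_integral M (\<lambda>\<omega>. (\<Sum>i\<in>S. c i * (W (b i) \<omega> - W (a i) \<omega>))\<^sup>2) ?v"
    by (rule has_bochner_integral_square_sum) (intro increment_covariance nn)
  then have 1: "(\<integral>\<^sup>+\<omega>. ennreal ((\<Sum>i\<in>S. c i * (W (b i) \<omega> - W (a i) \<omega>))\<^sup>2) \<partial>M) = ennreal ?v"
    by (subst nn_integral_eq_integral) (auto simp: has_bochner_integral_iff)
  have "has_bochner_integral lborel (\<lambda>s. (\<Sum>i\<in>S. c i * indicator {a i<..b i} s)\<^sup>2) ?v"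
    by (rule has_bochner_integral_square_sum) (intro has_bochner_integral_indicator_product nn)
  then have 2: "(\<integral>\<^sup>+s. ennreal ((\<Sum>i\<in>S. c i * indicator {a i<..b i} s)\<^sup>2) \<partial>lborel) = ennreal ?v"
    by (subst nn_integral_eq_integral) (auto simp: has_bochner_integral_iff)
  show ?thesis using 1 2 by simp
qed

lemma step_integral_diff_isometry:
  assumes p: "partition_of t n \<tau>" and p': "partition_of t n' \<tau>'"
  shows "(\<integral>\<^sup>+\<omega>. ennreal ((step_integral W n \<tau> c \<omega> - step_integral W n' \<tau>' c' \<omega>)\<^sup>2) \<partial>M) =
    (\<integral>\<^sup>+s. ennreal ((step_fun n \<tau> c s - step_fun n' \<tau>' c' s)\<^sup>2) \<partial>lborel)"
proof -
  \<comment> \<open>The disjoint sum of the index sets merges both step functions into one family;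
    negated coefficients produce the difference.\<close>
  let ?S = "{..<n} <+> {..<n'}"
  let ?a = "case_sum \<tau> \<tau>'" and ?b = "case_sum (\<lambda>i. \<tau> (Suc i)) (\<lambda>i. \<tau>' (Suc i))"
    and ?c = "case_sum c (\<lambda>i. - c' i)"
  have "0 \<le> ?a i \<and> ?a i \<le> ?b i" if "i \<in> ?S" for i
    using that partition_of_nonneg[OF p] partition_of_nonneg[OF p'] p p'
    by (auto simp: partition_of_def)
  note ito_isometry[OF this, of ?S "\<lambda>i. i" ?c]
  then show ?thesis
    by (simp add: sum.Plus step_integral_def step_fun_def sum_negf del: sum_mult_indicator)
qed

text \<open>The definition only provides some approximating sequence. By the isometry, step
  functions with the same limit have elementary integrals with the same limit, so any convenient
  sequence can be used.\<close>

lemma wiener_integral_approximation: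
  assumes Y: "is_wiener_integral M W t f Y"
    and q: "\<And>k. partition_of t (n k) (\<tau> k)"
    and lim: "(\<lambda>k. \<integral>\<^sup>+s\<in>{0..t}. ennreal ((f s - step_fun (n k) (\<tau> k) (c k) s)\<^sup>2) \<partial>lborel) \<longlonglongrightarrow> 0"
  shows "(\<lambda>k. \<integral>\<^sup>+\<omega>. ennreal ((Y \<omega> - step_integral W (n k) (\<tau> k) (c k) \<omega>)\<^sup>2) \<partial>M) \<longlonglongrightarrow> 0"
proof -
  obtain n' \<tau>' c' where p: "\<And>k. partition_of t (n' k) (\<tau>' k)"
    and lim1: "(\<lambda>k. \<integral>\<^sup>+s\<in>{0..t}. ennreal ((f s - step_fun (n' k) (\<tau>' k) (c' k) s)\<^sup>2) \<partial>lborel) \<longlonglongrightarrow> 0"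
    and lim2: "(\<lambda>k. \<integral>\<^sup>+\<omega>. ennreal ((Y \<omega> - step_integral W (n' k) (\<tau>' k) (c' k) \<omega>)\<^sup>2) \<partial>M) \<longlonglongrightarrow> 0"
    and [measurable]: "Y \<in> borel_measurable M"
    and "set_borel_measurable lborel {0..t} f"
    using Y unfolding is_wiener_integral_def by auto
  define g where "g s = indicator {0..t} s * f s" for s
  have [measurable]: "g \<in> borel_measurable lborel"
    using \<open>set_borel_measurable lborel {0..t} f\<close> by (simp add: set_borel_measurable_def g_def[abs_def])
  define P where "P k = step_fun (n' k) (\<tau>' k) (c' k)" for k
  define Q where "Q k = step_fun (n k) (\<tau> k) (c k)" for k
  define IP where "IP k = step_integral W (n' k) (\<tau>' k) (c' k)" for k
  define IQ where "IQ k = step_integral W (n k) (\<tau> k) (c k)" for k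
  have [measurable]: "P k \<in> borel_measurable borel" "Q k \<in> borel_measurable borel" for k
    by (auto simp: P_def Q_def)
  have [measurable]: "IP k \<in> borel_measurable M" "IQ k \<in> borel_measurable M" for k
    unfolding IP_def IQ_def
    by (rule subsetD[OF brownian_span_measurable], rule step_integral_brownian_span, rule p q)+
  \<comment> \<open>Step functions vanish outside \<open>{0..t}\<close>, so with \<open>f\<close>
    cut off to \<open>g\<close> the integral may run over the whole line, where the isometry
    applies.\<close>
  have restrict: "(\<integral>\<^sup>+s\<in>{0..t}. ennreal ((f s - h s)\<^sup>2) \<partial>lborel) = (\<integral>\<^sup>+s. ennreal ((g s - h s)\<^sup>2) \<partial>lborel)"
    if "\<And>s. s \<notin> {0..t} \<Longrightarrow> h s = 0" for h
    by (rule nn_integral_cong) (use that in \<open>auto simp: g_def indicator_def\<close>)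
  have l1: "(\<lambda>k. \<integral>\<^sup>+s. ennreal ((g s - P k s)\<^sup>2) \<partial>lborel) \<longlonglongrightarrow> 0"
    using lim1 restrict[of "P _"] step_fun_outside[OF p] by (simp add: P_def)
  have l2: "(\<lambda>k. \<integral>\<^sup>+s. ennreal ((g s - Q k s)\<^sup>2) \<partial>lborel) \<longlonglongrightarrow> 0"
    using lim restrict[of "Q _"] step_fun_outside[OF q] by (simp add: Q_def)
  have le: "(\<integral>\<^sup>+\<omega>. ennreal ((Y \<omega> - IQ k \<omega>)\<^sup>2) \<partial>M) \<le>
      2 * (\<integral>\<^sup>+\<omega>. ennreal ((Y \<omega> - IP k \<omega>)\<^sup>2) \<partial>M) +
      2 * (2 * (\<integral>\<^sup>+s. ennreal ((g s - P k s)\<^sup>2) \<partial>lborel) + 2 * (\<integral>\<^sup>+s. ennreal ((g s - Q k s)\<^sup>2) \<partial>lborel))" for k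
  proof -
    have "(\<integral>\<^sup>+\<omega>. ennreal ((Y \<omega> - IQ k \<omega>)\<^sup>2) \<partial>M) \<le>
      2 * (\<integral>\<^sup>+\<omega>. ennreal ((Y \<omega> - IP k \<omega>)\<^sup>2) \<partial>M) + 2 * (\<integral>\<^sup>+\<omega>. ennreal ((IP k \<omega> - IQ k \<omega>)\<^sup>2) \<partial>M)"
      by (rule nn_integral_square_diff_triangle) auto
    also have "(\<integral>\<^sup>+\<omega>. ennreal ((IP k \<omega> - IQ k \<omega>)\<^sup>2) \<partial>M) = (\<integral>\<^sup>+s. ennreal ((P k s - Q k s)\<^sup>2) \<partial>lborel)"
      unfolding IP_def IQ_def P_def Q_def by (rule step_integral_diff_isometry[OF p q])
    also have "\<dots> \<le> 2 * (\<integral>\<^sup>+s. ennreal ((P k s - g s)\<^sup>2) \<partial>lborel) + 2 * (\<integral>\<^sup>+s. ennreal ((g s - Q k s)\<^sup>2) \<partial>lborel)"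
      by (rule nn_integral_square_diff_triangle) auto
    finally show ?thesis
      by (simp add: power2_commute[of "P k _"] add_left_mono mult_left_mono)
  qed
  have "(\<lambda>k. 2 * (\<integral>\<^sup>+\<omega>. ennreal ((Y \<omega> - IP k \<omega>)\<^sup>2) \<partial>M) +
      2 * (2 * (\<integral>\<^sup>+s. ennreal ((g s - P k s)\<^sup>2) \<partial>lborel) + 2 * (\<integral>\<^sup>+s. ennreal ((g s - Q k s)\<^sup>2) \<partial>lborel)))
      \<longlonglongrightarrow> 2 * 0 + 2 * (2 * 0 + 2 * 0)"
    using lim2 unfolding IP_def[symmetric]
    by (intro tendsto_add ennreal_tendsto_cmult l1 l2) auto
  then have "(\<lambda>k. \<integral>\<^sup>+\<omega>. ennreal ((Y \<omega> - IQ k \<omega>)\<^sup>2) \<partial>M) \<longlonglongrightarrow> 0"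
    using tendsto_upperbound_zero_ennreal[OF _ le] by simp
  then show ?thesis by (simp add: IQ_def)
qed

end

section \<open>Modulus of continuity along dyadic times\<close>

text \<open>A discrete version of integrating \<open>a + d * u\<close> against
  \<open>exp (- u)\<close>: an antiderivative is \<open>exp (- u) * (a + d * (1 + u))\<close>, whose
  value at \<open>u = 0\<close> is \<open>a + d\<close>.\<close>

lemma abel_summation_exp_bound:
  fixes u y :: "nat \<Rightarrow> real"
  assumes dec: "\<And>i. i < n \<Longrightarrow> u (Suc i) \<le> u i" and "u n = 0"
    and y: "\<And>i. i \<le> n \<Longrightarrow> \<bar>y n - y i\<bar> \<le> B * (a + d * u i)"
    and nonneg: "0 \<le> B" "0 \<le> d"
  shows "\<bar>\<Sum>i<n. exp (- u i) * (y (Suc i) - y i)\<bar> \<le> B * (a + d)"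
proof -
  let ?f = "\<lambda>i. exp (- u i)"
  \<comment> \<open>The term in \<open>y n - y k\<close> is the remainder of the summation by parts
    and vanishes at \<open>k = n\<close>; the bound is \<open>B\<close> times that antiderivative at
    \<open>u k\<close>.\<close>
  have "k \<le> n \<Longrightarrow> \<bar>(\<Sum>i<k. ?f i * (y (Suc i) - y i)) + ?f k * (y n - y k)\<bar>
      \<le> B * (?f k * a + d * (?f k + ?f k * u k))" for k
  proof (induction k)
    case 0
    have "\<bar>?f 0 * (y n - y 0)\<bar> \<le> ?f 0 * (B * (a + d * u 0))"
      unfolding abs_mult using y[of 0] by (simp add: mult_left_mono)
    also have "\<dots> \<le> ?f 0 * (B * (a + d * u 0)) + B * (d * ?f 0)" using nonneg by simp
    finally show ?case by (simp add: algebra_simps)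
  next
    case (Suc k)
    let ?g = "?f (Suc k)" and ?S = "(\<Sum>i<k. ?f i * (y (Suc i) - y i)) + ?f k * (y n - y k)"
    have mono: "?f k \<le> ?g" using dec[of k] Suc by simp
    \<comment> \<open>The inequality \<open>1 + x \<le> exp x\<close> replaces the exact
      antiderivative when \<open>u\<close> drops by a finite step.\<close>
    have "?f k * (1 + (u k - u (Suc k))) \<le> ?f k * exp (u k - u (Suc k))"
      by (intro mult_left_mono exp_ge_add_one_self) auto
    also have "\<dots> = ?g" by (simp flip: exp_add)
    finally have key: "?f k + ?f k * u k - ?f k * u (Suc k) \<le> ?g" by (simp add: algebra_simps)
    have "\<bar>(?g - ?f k) * (y n - y (Suc k))\<bar> \<le> (?g - ?f k) * (B * (a + d * u (Suc k)))"
      unfolding abs_mult using mono y[of "Suc k"] Suc.prems by (simp add: mult_left_mono)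
    moreover have "(\<Sum>i<Suc k. ?f i * (y (Suc i) - y i)) + ?g * (y n - y (Suc k))
        = ?S + (?g - ?f k) * (y n - y (Suc k))" by (simp add: algebra_simps)
    ultimately have "\<bar>(\<Sum>i<Suc k. ?f i * (y (Suc i) - y i)) + ?g * (y n - y (Suc k))\<bar>
        \<le> B * (?f k * a + d * (?f k + ?f k * u k)) + (?g - ?f k) * (B * (a + d * u (Suc k)))"
      using Suc by linarith
    also have "\<dots> = B * (?g * a + d * ((?f k + ?f k * u k - ?f k * u (Suc k)) + ?g * u (Suc k)))"
      by (simp add: algebra_simps)
    also have "\<dots> \<le> B * (?g * a + d * (?g + ?g * u (Suc k)))"
      using key nonneg by (intro mult_left_mono add_left_mono add_right_mono)
    finally show ?case .
  qed
  from this[of n] show ?thesis using \<open>u n = 0\<close> by simp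
qed

text \<open>Rounding down to level \<open>K\<close> costs a geometric series in \<open>r\<close> at
  each end; the two grid points are then at most \<open>(t - s) * 2 ^ K + 1\<close> cells apart. The
  range \<open>2 ^ ((m + 1) * k)\<close> counts the cells of mesh \<open>1 / 2 ^ k\<close> up to
  time \<open>2 ^ (m * k)\<close>.\<close>

lemma dyadic_chaining:
  fixes w :: "real \<Rightarrow> real"
  assumes cont: "continuous_on {0..} w" and r: "0 < r" "r < 1"
    and inc: "\<And>k j. k0 \<le> k \<Longrightarrow> j < 2 ^ ((m + 1) * k) \<Longrightarrow>
      \<bar>w (real (Suc j) / 2 ^ k) - w (real j / 2 ^ k)\<bar> \<le> r ^ k"
    and K: "k0 \<le> K" and st: "0 \<le> s" "s \<le> t" "t < 2 ^ (m * K)"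
  shows "\<bar>w t - w s\<bar> \<le> r ^ K * (2 / (1 - r) + 1 + (t - s) * 2 ^ K)"
proof -
  define idx where "idx k x = nat \<lfloor>x * 2 ^ k\<rfloor>" for k :: nat and x :: real
  have idx: "real (idx k x) \<le> x * 2 ^ k" "x * 2 ^ k < real (idx k x) + 1" if "0 \<le> x" for k x
    using that by (auto simp: idx_def)
  define p where "p k x = real (idx k x) / 2 ^ k" for k x
  have approx: "\<bar>w x - w (p K x)\<bar> \<le> r ^ K / (1 - r)" if x: "0 \<le> x" "x < 2 ^ (m * K)" for x
  proof -
    have step: "\<bar>w (p (Suc k) x) - w (p k x)\<bar> \<le> r ^ k" if k: "K \<le> k" for k
    proof -
      let ?j = "idx k x"
      \<comment> \<open>Refining the grid appends one binary digit, so the index becomes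
        \<open>2 * ?j\<close> or its successor.\<close>
      have "real (idx (Suc k) x) < real (2 * ?j) + 2" "real (2 * ?j) < real (idx (Suc k) x) + 1"
        using idx[OF x(1), of k] idx[OF x(1), of "Suc k"] by auto
      then have "idx (Suc k) x < 2 * ?j + 2" "2 * ?j < idx (Suc k) x + 1" by linarith+
      then consider "idx (Suc k) x = 2 * ?j" | "idx (Suc k) x = Suc (2 * ?j)" by linarith
      then show ?thesis
      proof cases
        case 1
        then have "p (Suc k) x = p k x" by (simp add: p_def)
        then show ?thesis using r by simp
      next
        case 2
        have "real (2 * ?j) \<le> x * 2 ^ Suc k" using idx(1)[OF x(1), of k] by simp
        also have "\<dots> < 2 ^ (m * K) * 2 ^ Suc k" using x by (intro mult_strict_right_mono) auto
        also have "\<dots> = 2 ^ (m * K + Suc k)" by (simp add: power_add)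
        also have "\<dots> \<le> 2 ^ ((m + 1) * Suc k)" using k
          by (intro power_increasing) (auto intro: trans_le_add2)
        finally have "real (2 * ?j) < real (2 ^ ((m + 1) * Suc k))" by simp
        then have "2 * ?j < 2 ^ ((m + 1) * Suc k)" by (simp only: of_nat_less_iff)
        then have "\<bar>w (real (Suc (2 * ?j)) / 2 ^ Suc k) - w (real (2 * ?j) / 2 ^ Suc k)\<bar> \<le> r ^ Suc k"
          using K k by (intro inc) auto
        moreover have "p k x = real (2 * ?j) / 2 ^ Suc k" by (simp add: p_def)
        moreover have "p (Suc k) x = real (Suc (2 * ?j)) / 2 ^ Suc k" by (simp add: p_def 2)
        ultimately have "\<bar>w (p (Suc k) x) - w (p k x)\<bar> \<le> r ^ Suc k" by simp
        also have "\<dots> \<le> r ^ k" using r by (intro power_decreasing) auto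
        finally show ?thesis .
      qed
    qed
    \<comment> \<open>The exact geometric sum makes the induction close; dropping
      \<open>r ^ n\<close> then gives a bound free of \<open>n\<close>.\<close>
    have part: "\<bar>w (p (K + n) x) - w (p K x)\<bar> \<le> r ^ K * (1 - r ^ n) / (1 - r)" for n
    proof (induction n)
      case (Suc n)
      have "\<bar>w (p (K + Suc n) x) - w (p K x)\<bar> \<le> r ^ K * (1 - r ^ n) / (1 - r) + r ^ (K + n)"
        using Suc step[of "K + n"] by simp
      also have "\<dots> = r ^ K * (1 - r ^ Suc n) / (1 - r)"
        using r by (simp add: field_simps power_add)
      finally show ?case .
    qed simp
    have bd: "\<bar>w (p (K + n) x) - w (p K x)\<bar> \<le> r ^ K / (1 - r)" for n
      by (rule order_trans[OF part]) (use r in \<open>auto intro!: divide_right_mono mult_left_le\<close>)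
    have "(\<lambda>n. p (K + n) x) \<longlonglongrightarrow> x"
    proof (rule real_tendsto_sandwich[where f="\<lambda>n. x - (1 / 2) ^ n" and h="\<lambda>_. x"])
      show "eventually (\<lambda>n. x - (1 / 2) ^ n \<le> p (K + n) x) sequentially"
      proof (rule always_eventually, rule allI)
        fix n
        have "x - 1 / 2 ^ (K + n) \<le> p (K + n) x"
          unfolding p_def diff_divide_distrib[symmetric]
          using idx(2)[OF x(1), of "K + n"] by (simp add: le_divide_eq left_diff_distrib)
        moreover have "1 / 2 ^ (K + n) \<le> (1 / 2 :: real) ^ n"
          by (simp add: power_one_over divide_simps)
        ultimately show "x - (1 / 2) ^ n \<le> p (K + n) x" by linarith
      qed
      show "eventually (\<lambda>n. p (K + n) x \<le> x) sequentially"
        using idx(1)[OF x(1)] by (auto simp: p_def field_simps)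
      have "(\<lambda>n. x - (1 / 2) ^ n) \<longlonglongrightarrow> x - 0"
        by (intro tendsto_diff tendsto_const LIMSEQ_power_zero) auto
      then show "(\<lambda>n. x - (1 / 2) ^ n) \<longlonglongrightarrow> x" by simp
    qed simp
    then have "(\<lambda>n. w (p (K + n) x)) \<longlonglongrightarrow> w x"
      by (rule continuous_on_tendsto_compose[OF cont]) (use x in \<open>auto simp: p_def\<close>)
    then have "(\<lambda>n. \<bar>w (p (K + n) x) - w (p K x)\<bar>) \<longlonglongrightarrow> \<bar>w x - w (p K x)\<bar>"
      by (intro tendsto_intros)
    then show ?thesis by (rule LIMSEQ_le_const2) (use bd in auto)
  qed
  \<comment> \<open>The right endpoint may equal \<open>2 ^ ((m + 1) * K)\<close>, since
    \<open>inc\<close> restricts the left end of each cell.\<close>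
  have coarse: "\<bar>w (real (i + n) / 2 ^ K) - w (real i / 2 ^ K)\<bar> \<le> real n * r ^ K"
    if "i + n \<le> 2 ^ ((m + 1) * K)" for i n
    using that
  proof (induction n)
    case (Suc n)
    have "\<bar>w (real (Suc (i + n)) / 2 ^ K) - w (real (i + n) / 2 ^ K)\<bar> \<le> r ^ K"
      using Suc.prems K by (intro inc) auto
    then show ?case using Suc by (simp add: algebra_simps)
  qed simp
  have le: "idx K s \<le> idx K t" unfolding idx_def using st by (intro nat_mono floor_mono) simp
  have "real (idx K t) \<le> t * 2 ^ K" using idx(1)[of t] st by simp
  also have "\<dots> \<le> 2 ^ (m * K) * 2 ^ K" using st by (intro mult_right_mono) auto
  finally have "real (idx K t) \<le> real (2 ^ ((m + 1) * K))" by (simp add: power_add mult.commute)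
  then have "idx K t \<le> 2 ^ ((m + 1) * K)" by (simp only: of_nat_le_iff)
  then have "\<bar>w (p K t) - w (p K s)\<bar> \<le> real (idx K t - idx K s) * r ^ K"
    using coarse[of "idx K s" "idx K t - idx K s"] le by (simp add: p_def)
  \<comment> \<open>The \<open>+ 1\<close> pays for rounding \<open>s\<close> down.\<close>
  also have "\<dots> \<le> ((t - s) * 2 ^ K + 1) * r ^ K"
    using idx[of t K] idx[of s K] st le r
    by (intro mult_right_mono) (auto simp: of_nat_diff algebra_simps)
  finally have "\<bar>w (p K t) - w (p K s)\<bar> \<le> ((t - s) * 2 ^ K + 1) * r ^ K" .
  moreover have "\<bar>w t - w (p K t)\<bar> \<le> r ^ K / (1 - r)" "\<bar>w s - w (p K s)\<bar> \<le> r ^ K / (1 - r)"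
    using approx[of t] approx[of s] st by auto
  ultimately have "\<bar>w t - w s\<bar> \<le> r ^ K / (1 - r) + r ^ K / (1 - r) + ((t - s) * 2 ^ K + 1) * r ^ K"
    by linarith
  also have "\<dots> = r ^ K * (2 / (1 - r) + 1 + (t - s) * 2 ^ K)"
    by (simp add: algebra_simps)
  finally show ?thesis .
qed

text \<open>An increment over a cell has size about \<open>2^(-k/2)\<close>, well below the
  threshold \<open>r ^ k\<close>, which is \<open>2^(-k/4)\<close>. Markov's inequality for a high
  enough moment beats the number of cells, and Borel-Cantelli concludes.\<close>

lemma (in standard_brownian_motion) dyadic_increments_eventually_small:
  fixes r :: real and m :: nat
  assumes r: "0 < r" "r ^ 4 = 1 / 2"
  shows "AE \<omega> in M. \<exists>k0. \<forall>k\<ge>k0. \<forall>j<2 ^ ((m + 1) * k).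
    \<bar>W (real (Suc j) / 2 ^ k) \<omega> - W (real j / 2 ^ k) \<omega>\<bar> \<le> r ^ k"
proof -
  \<comment> \<open>The moment of order \<open>4 * q\<close> bounds each exceptional probability by
    \<open>C / 2 ^ (q * k)\<close>; with \<open>2 ^ ((m + 1) * k)\<close> cells,
    \<open>q = m + 2\<close> leaves the summable \<open>C / 2 ^ k\<close>.\<close>
  define q where "q = m + 2"
  define C :: real where "C = fact (2 * (2 * q)) / (2 ^ (2 * q) * fact (2 * q))"
  define \<Delta> where "\<Delta> k j \<omega> = W (real (Suc j) / 2 ^ k) \<omega> - W (real j / 2 ^ k) \<omega>" for k j :: nat and \<omega>
  have [measurable]: "\<Delta> k j \<in> borel_measurable M" for k j
    unfolding \<Delta>_def by (intro borel_measurable_diff brownian_measurable) auto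
  define A where "A k = (\<Union>j<2 ^ ((m + 1) * k). {\<omega> \<in> space M. r ^ k < \<bar>\<Delta> k j \<omega>\<bar>})" for k
  have [measurable]: "A k \<in> sets M" for k unfolding A_def by measurable
  have single: "measure M {\<omega> \<in> space M. r ^ k < \<bar>\<Delta> k j \<omega>\<bar>} \<le> C * (1 / 2) ^ (q * k)" for k j
  proof -
    have mom: "has_bochner_integral M (\<lambda>\<omega>. \<Delta> k j \<omega> ^ (2 * (2 * q))) (C * ((1 / 2) ^ k) ^ (2 * q))"
    proof -
      have "real (Suc j) / 2 ^ k - real j / 2 ^ k = (1 / 2) ^ k"
        by (simp add: field_simps power_one_over)
      then show ?thesis
        using increment_even_moment[of "real j / 2 ^ k" "real (Suc j) / 2 ^ k" "2 * q"]
        by (simp add: \<Delta>_def C_def divide_strict_right_mono)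
    qed
    have rq: "(r ^ k) ^ (2 * (2 * q)) = (1 / 2) ^ (q * k)"
    proof -
      have "(r ^ k) ^ (2 * (2 * q)) = (r ^ 4) ^ (q * k)" by (simp flip: power_mult add: ac_simps)
      then show ?thesis by (simp add: r)
    qed
    have "measure M {\<omega> \<in> space M. r ^ k < \<bar>\<Delta> k j \<omega>\<bar>} \<le>
        measure M {\<omega> \<in> space M. \<Delta> k j \<omega> ^ (2 * (2 * q)) \<ge> (1 / 2) ^ (q * k)}"
    proof (rule finite_measure_mono)
      show "{\<omega> \<in> space M. r ^ k < \<bar>\<Delta> k j \<omega>\<bar>} \<subseteq>
          {\<omega> \<in> space M. \<Delta> k j \<omega> ^ (2 * (2 * q)) \<ge> (1 / 2) ^ (q * k)}"
      proof safe
        fix \<omega> assume "r ^ k < \<bar>\<Delta> k j \<omega>\<bar>"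
        then have "(r ^ k) ^ (2 * (2 * q)) \<le> \<bar>\<Delta> k j \<omega>\<bar> ^ (2 * (2 * q))"
          using r by (intro power_mono) auto
        then show "(1 / 2) ^ (q * k) \<le> \<Delta> k j \<omega> ^ (2 * (2 * q))"
          unfolding rq by (simp add: power_even_abs)
      qed
    qed measurable
    also have "\<dots> \<le> (\<integral>\<omega>. \<Delta> k j \<omega> ^ (2 * (2 * q)) \<partial>M) / (1 / 2) ^ (q * k)"
      using mom by (intro integral_Markov_inequality_measure[where A="{}"])
        (auto simp: has_bochner_integral_iff zero_le_even_power)
    also have "\<dots> = C * ((1 / 2) ^ k) ^ (2 * q) / (1 / 2) ^ (q * k)"
      using mom by (simp add: has_bochner_integral_iff)
    also have "((1 / 2 :: real) ^ k) ^ (2 * q) = (1 / 2) ^ (q * k) * (1 / 2) ^ (q * k)"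
      unfolding power_mult[symmetric] power_add[symmetric] by (rule arg_cong) simp
    finally show ?thesis by simp
  qed
  have bound: "measure M (A k) \<le> C * (1 / 2) ^ k" for k
  proof -
    have "measure M (A k) \<le> (\<Sum>j<2 ^ ((m + 1) * k). measure M {\<omega> \<in> space M. r ^ k < \<bar>\<Delta> k j \<omega>\<bar>})"
      unfolding A_def by (rule finite_measure_subadditive_finite) auto
    also have "\<dots> \<le> (\<Sum>j<(2::nat) ^ ((m + 1) * k). C * (1 / 2) ^ (q * k))"
      by (intro sum_mono single)
    also have "\<dots> = 2 ^ ((m + 1) * k) * (C * (1 / 2) ^ (q * k))" by simp
    also have "(1 / 2 :: real) ^ (q * k) = (1 / 2) ^ ((m + 1) * k) * (1 / 2) ^ k"
      by (simp add: q_def power_add algebra_simps)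
    also have "2 ^ ((m + 1) * k) * (C * ((1 / 2) ^ ((m + 1) * k) * (1 / 2) ^ k)) = C * (1 / 2) ^ k"
      by (simp add: power_one_over)
    finally show ?thesis .
  qed
  have "summable (\<lambda>k. C * (1 / 2) ^ k)" by (intro summable_mult summable_geometric) auto
  then have "summable (\<lambda>k. measure M (A k))"
    by (rule summable_comparison_test') (use bound in auto)
  from borel_cantelli_AE1[OF _ _ this]
  have "AE \<omega> in M. eventually (\<lambda>k. \<omega> \<in> space M - A k) sequentially"
    by (auto simp: emeasure_eq_measure)
  then show ?thesis
  proof eventually_elim
    case (elim \<omega>)
    then show ?case
      by (auto simp: eventually_sequentially A_def \<Delta>_def not_less)
  qed
qed

section \<open>Pathwise bound on the Wiener integral\<close>

lemma step_fun_eq: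
  assumes p: "partition_of t n \<tau>" and i: "i < n" "s \<in> {\<tau> i<..\<tau> (Suc i)}"
  shows "step_fun n \<tau> c s = c i"
proof -
  have "indicator {\<tau> j<..\<tau> (Suc j)} s = (if j = i then 1 else 0 :: real)" if "j < n" for j
  proof -
    consider "j < i" | "j = i" | "i < j" by linarith
    then show ?thesis
    proof cases
      case 1
      then have "\<tau> (Suc j) \<le> \<tau> i" using i by (intro partition_of_mono[OF p]) auto
      then show ?thesis using 1 i by auto
    next
      case 3
      then have "\<tau> (Suc i) \<le> \<tau> j" using that by (intro partition_of_mono[OF p]) auto
      then show ?thesis using 3 i by auto
    qed (use i in auto)
  qed
  then have "step_fun n \<tau> c s = (\<Sum>j<n. if j = i then c j else 0)"
    unfolding step_fun_def by (intro sum.cong) auto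
  then show ?thesis using i by simp
qed

text \<open>The cell ends at the first partition point that is not below \<open>s\<close>. Cells are
  open on the left, so 0 lies in none.\<close>

lemma partition_of_cover:
  assumes p: "partition_of t n \<tau>" and s: "0 < s" "s \<le> t"
  obtains i where "i < n" "s \<in> {\<tau> i<..\<tau> (Suc i)}"
proof -
  define j where "j = (LEAST j. s \<le> \<tau> j)"
  have n: "s \<le> \<tau> n" using s p by (simp add: partition_of_def)
  have j: "s \<le> \<tau> j" unfolding j_def by (rule LeastI[of _ n]) (rule n)
  have "j \<le> n" unfolding j_def by (rule Least_le) (rule n)
  moreover have "j \<noteq> 0"
  proof
    assume "j = 0"
    then show False using j s p by (simp add: partition_of_def)
  qed
  moreover have "\<not> s \<le> \<tau> (j - 1)"
    using \<open>j \<noteq> 0\<close> unfolding j_def by (intro not_less_Least) simp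
  ultimately show ?thesis using j by (intro that[of "j - 1"]) auto
qed

lemma partition_of_uniform:
  assumes "0 \<le> t"
  shows "partition_of t (Suc k) (\<lambda>i. t * real i / real (Suc k))"
  using assms unfolding partition_of_def
  by (auto intro!: divide_right_mono mult_left_mono simp del: of_nat_Suc)

section \<open>The kernel \<open>exp (- integral {s..t} \<alpha>)\<close>\<close>

context
  fixes \<alpha> :: "real \<Rightarrow> real"
  assumes alpha_cont: "continuous_on {0..} \<alpha>" and alpha_nonneg: "\<And>t. 0 \<le> t \<Longrightarrow> 0 \<le> \<alpha> t"
begin

lemma rate_integrable: "0 \<le> s \<Longrightarrow> \<alpha> integrable_on {s..t}"
  by (rule integrable_continuous_real, rule continuous_on_subset[OF alpha_cont]) auto

lemma rate_integral_split:
  "0 \<le> s \<Longrightarrow> s \<le> s' \<Longrightarrow> s' \<le> t \<Longrightarrow>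
    integral {s..t} \<alpha> = integral {s..s'} \<alpha> + integral {s'..t} \<alpha>"
  by (rule Henstock_Kurzweil_Integration.integral_combine[symmetric]) (auto intro: rate_integrable)

lemma rate_integral_nonneg: "0 \<le> s \<Longrightarrow> 0 \<le> integral {s..t} \<alpha>"
  by (rule integral_nonneg) (auto intro: rate_integrable alpha_nonneg)

lemma rate_integral_antimono:
  "0 \<le> s \<Longrightarrow> s \<le> s' \<Longrightarrow> s' \<le> t \<Longrightarrow> integral {s'..t} \<alpha> \<le> integral {s..t} \<alpha>"
  using rate_integral_split[of s s' t] rate_integral_nonneg[of s s'] by simp

text \<open>With \<open>x = integral {s..s'} \<alpha>\<close>, the difference factors into
  \<open>exp (- integral {s'..t} \<alpha>)\<close>, which is at most 1, and
  \<open>1 - exp (- x)\<close>, which is at most \<open>x\<close>. A bound \<open>B\<close> of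
  \<alpha> on \<open>{0..t}\<close> finishes.\<close>

lemma exp_rate_integral_lipschitz:
  assumes "0 \<le> t"
  obtains B where "0 \<le> B" and
    "\<And>s s'. 0 \<le> s \<Longrightarrow> s \<le> s' \<Longrightarrow> s' \<le> t \<Longrightarrow>
      \<bar>exp (- integral {s'..t} \<alpha>) - exp (- integral {s..t} \<alpha>)\<bar> \<le> B * (s' - s)"
proof -
  have "compact (\<alpha> ` {0..t})"
    by (intro compact_continuous_image continuous_on_subset[OF alpha_cont]) auto
  then have "bounded (\<alpha> ` {0..t})" by (rule compact_imp_bounded)
  then obtain B where B: "\<And>x. x \<in> {0..t} \<Longrightarrow> \<bar>\<alpha> x\<bar> \<le> B" 
    unfolding bounded_iff real_norm_def by blast
  have "0 \<le> B" using B[of 0] assms by auto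
  moreover have "\<bar>exp (- integral {s'..t} \<alpha>) - exp (- integral {s..t} \<alpha>)\<bar> \<le> B * (s' - s)"
    if "0 \<le> s" "s \<le> s'" "s' \<le> t" for s s'
  proof -
    let ?d = "integral {s..s'} \<alpha>" and ?e = "exp (- integral {s'..t} \<alpha>)"
    have e: "0 \<le> ?e" "?e \<le> 1" using rate_integral_nonneg[of s' t] that by auto
    have d: "0 \<le> ?d" using rate_integral_nonneg that by auto
    have "exp (- integral {s'..t} \<alpha>) - exp (- integral {s..t} \<alpha>) = ?e * (1 - exp (- ?d))"
      using that by (simp add: rate_integral_split[of s s' t] right_diff_distrib flip: exp_add)
    moreover have "0 \<le> 1 - exp (- ?d)" "1 - exp (- ?d) \<le> ?d"
      using d exp_ge_add_one_self[of "- ?d"] by auto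
    moreover from this have "?e * (1 - exp (- ?d)) \<le> 1 * ?d"
      using e by (intro mult_mono) auto
    ultimately have "\<bar>exp (- integral {s'..t} \<alpha>) - exp (- integral {s..t} \<alpha>)\<bar> \<le> ?d"
      using e by (simp add: abs_mult)
    also have "?d \<le> integral {s..s'} (\<lambda>_. B)"
      using that B by (intro integral_le rate_integrable) (auto simp: abs_le_iff)
    also have "\<dots> = B * (s' - s)" using that by simp
    finally show ?thesis .
  qed
  ultimately show ?thesis by (rule that)
qed

text \<open>The kernel is Lipschitz, so freezing it at the left ends of cells of length
  \<open>t / Suc k\<close> makes a uniform error of order \<open>1 / k\<close>. Left ends match the
  sums in \<open>abel_summation_exp_bound\<close>.\<close>

lemma exp_rate_step_fun_L2:
  assumes t: "0 \<le> t"
  shows "(\<lambda>k. \<integral>\<^sup>+s\<in>{0..t}. ennreal ((exp (- integral {s..t} \<alpha>) -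
      step_fun (Suc k) (\<lambda>i. t * real i / real (Suc k))
        (\<lambda>i. exp (- integral {t * real i / real (Suc k)..t} \<alpha>)) s)\<^sup>2) \<partial>lborel) \<longlonglongrightarrow> 0"
proof -
  obtain B where B: "0 \<le> B" "\<And>s s'. 0 \<le> s \<Longrightarrow> s \<le> s' \<Longrightarrow> s' \<le> t \<Longrightarrow>
      \<bar>exp (- integral {s'..t} \<alpha>) - exp (- integral {s..t} \<alpha>)\<bar> \<le> B * (s' - s)"
    using exp_rate_integral_lipschitz[OF t] by blast
  define f where "f s = exp (- integral {s..t} \<alpha>)" for s
  define \<tau> where "\<tau> k i = t * real i / real (Suc k)" for k i
  define g where "g k = step_fun (Suc k) (\<tau> k) (\<lambda>i. f (\<tau> k i))" for k
  have p: "partition_of t (Suc k) (\<tau> k)" for k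
    unfolding \<tau>_def using t by (rule partition_of_uniform)
  have close: "(f s - g k s)\<^sup>2 \<le> (B * t / real (Suc k))\<^sup>2" if s: "0 < s" "s \<le> t" for s k
  proof -
    obtain i where i: "i < Suc k" "s \<in> {\<tau> k i<..\<tau> k (Suc i)}"
      using partition_of_cover[OF p s] by blast
    have "g k s = f (\<tau> k i)" unfolding g_def by (rule step_fun_eq[OF p i])
    moreover have "\<bar>f s - f (\<tau> k i)\<bar> \<le> B * (s - \<tau> k i)"
      unfolding f_def using i s partition_of_nonneg[OF p, of i] by (intro B(2)) auto
    moreover have "\<dots> \<le> B * (t / real (Suc k))"
    proof (rule mult_left_mono[OF _ B(1)])
      have "\<tau> k (Suc i) = \<tau> k i + t / real (Suc k)" 
        unfolding \<tau>_def add_divide_distrib[symmetric] by (simp add: algebra_simps)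
      then show "s - \<tau> k i \<le> t / real (Suc k)" using i by simp
    qed
    ultimately have "\<bar>f s - g k s\<bar> \<le> \<bar>B * t / real (Suc k)\<bar>" using B t by simp
    then show ?thesis by (simp only: abs_le_square_iff)
  qed
  have le: "(\<integral>\<^sup>+s\<in>{0..t}. ennreal ((f s - g k s)\<^sup>2) \<partial>lborel) \<le>
      ennreal ((B * t / real (Suc k))\<^sup>2 * t)" for k
  proof -
    have "(\<integral>\<^sup>+s\<in>{0..t}. ennreal ((f s - g k s)\<^sup>2) \<partial>lborel) \<le>
        (\<integral>\<^sup>+s\<in>{0..t}. ennreal ((B * t / real (Suc k))\<^sup>2) \<partial>lborel)"
    proof (rule nn_integral_mono_AE)
      show "AE s in lborel. ennreal ((f s - g k s)\<^sup>2) * indicator {0..t} s \<le>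
          ennreal ((B * t / real (Suc k))\<^sup>2) * indicator {0..t} s"
        \<comment> \<open>The point 0 lies in no cell, so it is discarded as a null set.\<close>
        using AE_lborel_singleton[of 0]
      proof eventually_elim
        case (elim s)
        then show ?case using close[of s k] by (auto simp: indicator_def intro: ennreal_leI)
      qed
    qed
    also have "\<dots> = ennreal ((B * t / real (Suc k))\<^sup>2 * t)"
      using t by (simp add: nn_integral_cmult_indicator ennreal_mult)
    finally show ?thesis .
  qed
  have "(\<lambda>k. (B * t / real (Suc k))\<^sup>2 * t) \<longlonglongrightarrow> 0\<^sup>2 * t"
    by (intro tendsto_intros LIMSEQ_Suc[OF lim_const_over_n])
  then have "(\<lambda>k. ennreal ((B * t / real (Suc k))\<^sup>2 * t)) \<longlonglongrightarrow> 0"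
    using tendsto_ennrealI by fastforce
  from tendsto_upperbound_zero_ennreal[OF this le]
  show ?thesis unfolding g_def f_def \<tau>_def .
qed

text \<open>Only the part of \<open>{s..t}\<close> to the right of \<open>t / 2\<close> counts: it
  has at least half the length, and there
  \<open>\<alpha> x \<ge> c * (t / 2) powr \<beta>\<close>.\<close>

lemma rate_integral_ge_linear:
  assumes lower: "\<And>x. 0 < x \<Longrightarrow> c * x powr \<beta> \<le> \<alpha> x" and "0 \<le> c" "0 \<le> \<beta>" "0 \<le> s" "s \<le> t" "0 < t"
  shows "c * (t / 2) powr \<beta> * ((t - s) / 2) \<le> integral {s..t} \<alpha>"
proof -
  define s' where "s' = max s (t / 2)"
  have s': "s \<le> s'" "s' \<le> t" "t / 2 \<le> s'" "0 \<le> s'" "(t - s) / 2 \<le> t - s'"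
    using assms by (auto simp: s'_def max_def)
  have "c * (t / 2) powr \<beta> * ((t - s) / 2) \<le> c * (t / 2) powr \<beta> * (t - s')"
    using assms s' by (intro mult_left_mono) auto
  also have "\<dots> = integral {s'..t} (\<lambda>_. c * (t / 2) powr \<beta>)" using s' by simp
  also have "\<dots> \<le> integral {s'..t} \<alpha>"
  proof (intro integral_le rate_integrable)
    fix x assume x: "x \<in> {s'..t}"
    have "c * (t / 2) powr \<beta> \<le> c * x powr \<beta>"
      using assms s' x by (intro mult_left_mono powr_mono2) auto
    also have "\<dots> \<le> \<alpha> x" using assms s' x by (intro lower) auto
    finally show "c * (t / 2) powr \<beta> \<le> \<alpha> x" .
  qed (use s' in auto)
  also have "\<dots> \<le> integral {s..t} \<alpha>" using s' assms by (intro rate_integral_antimono)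
  finally show ?thesis .
qed

end

text \<open>The Riemann sums at left ends converge to \<open>Y\<close> almost surely along a
  subsequence, and summation by parts bounds each of them. The constants are quantified inside the
  almost sure statement so that they may depend on the path.\<close>

lemma (in standard_brownian_motion) wiener_integral_pathwise_bound:
  assumes alpha: "continuous_on {0..} \<alpha>" "\<And>t. 0 \<le> t \<Longrightarrow> 0 \<le> \<alpha> t"
    and t: "0 \<le> t" and Y: "is_wiener_integral M W t (\<lambda>s. exp (- integral {s..t} \<alpha>)) Y"
  shows "AE \<omega> in M. \<forall>B a d. 0 \<le> B \<longrightarrow> 0 \<le> d \<longrightarrow>
    (\<forall>s\<in>{0..t}. \<bar>W t \<omega> - W s \<omega>\<bar> \<le> B * (a + d * integral {s..t} \<alpha>)) \<longrightarrow> \<bar>Y \<omega>\<bar> \<le> B * (a + d)"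
proof -
  define \<tau> where "\<tau> k i = t * real i / real (Suc k)" for k i
  define I where "I k = step_integral W (Suc k) (\<tau> k) (\<lambda>i. exp (- integral {\<tau> k i..t} \<alpha>))" for k
  have p: "partition_of t (Suc k) (\<tau> k)" for k
    unfolding \<tau>_def using t by (rule partition_of_uniform)
  have L2: "(\<lambda>k. \<integral>\<^sup>+\<omega>. ennreal ((Y \<omega> - I k \<omega>)\<^sup>2) \<partial>M) \<longlonglongrightarrow> 0"
    unfolding I_def
  proof (rule wiener_integral_approximation[OF Y p])
    show "(\<lambda>k. \<integral>\<^sup>+s\<in>{0..t}. ennreal ((exp (- integral {s..t} \<alpha>) - step_fun (Suc k) (\<tau> k)
        (\<lambda>i. exp (- integral {\<tau> k i..t} \<alpha>)) s)\<^sup>2) \<partial>lborel) \<longlonglongrightarrow> 0"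
      unfolding \<tau>_def using alpha t by (rule exp_rate_step_fun_L2)
  qed
  have "I k \<in> borel_measurable M" for k
    unfolding I_def by (rule subsetD[OF brownian_span_measurable step_integral_brownian_span[OF p]])
  moreover have "Y \<in> borel_measurable M" using Y by (simp add: is_wiener_integral_def)
  ultimately obtain \<nu> :: "nat \<Rightarrow> nat" where "AE \<omega> in M. (\<lambda>k. I (\<nu> k) \<omega>) \<longlonglongrightarrow> Y \<omega>"
    using L2_limit_AE_subseq[OF _ _ L2] by blast
  then show ?thesis
  proof eventually_elim
    case (elim \<omega>)
    have "\<bar>Y \<omega>\<bar> \<le> B * (a + d)"
      if "0 \<le> B" "0 \<le> d" and W: "\<forall>s\<in>{0..t}. \<bar>W t \<omega> - W s \<omega>\<bar> \<le> B * (a + d * integral {s..t} \<alpha>)"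
      for B a d
    proof -
      have last: "\<tau> k (Suc k) = t" for k by (simp add: \<tau>_def)
      have "\<bar>I k \<omega>\<bar> \<le> B * (a + d)" for k
        unfolding I_def step_integral_def
      proof (rule abel_summation_exp_bound)
        fix i assume "i < Suc k"
        then show "integral {\<tau> k (Suc i)..t} \<alpha> \<le> integral {\<tau> k i..t} \<alpha>"
          using partition_of_nonneg[OF p, of i] partition_of_le[OF p, of "Suc i"]
            partition_of_mono[OF p, of i "Suc i"]
          by (intro rate_integral_antimono alpha) auto
      next
        fix i assume "i \<le> Suc k"
        then show "\<bar>W (\<tau> k (Suc k)) \<omega> - W (\<tau> k i) \<omega>\<bar> \<le> B * (a + d * integral {\<tau> k i..t} \<alpha>)"
          using partition_of_nonneg[OF p, of i] partition_of_le[OF p, of i] W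
          by (simp add: last)
      qed (use that in \<open>auto simp: last\<close>)
      moreover have "(\<lambda>k. \<bar>I (\<nu> k) \<omega>\<bar>) \<longlonglongrightarrow> \<bar>Y \<omega>\<bar>" using elim by (rule tendsto_rabs)
      ultimately show ?thesis by (intro LIMSEQ_le_const2) auto
    qed
    then show ?case by blast
  qed
qed

section \<open>Decay at infinity\<close>

text \<open>The running supremum is at least \<open>\<alpha> 0\<close>, so the numerator stays above
  a positive constant and the bound on the quotient turns into a lower bound on \<alpha>.\<close>

lemma rate_power_lower_bound:
  fixes \<alpha> :: "real \<Rightarrow> real"
  assumes cont: "continuous_on {0..} \<alpha>" and pos: "\<And>t. 0 \<le> t \<Longrightarrow> 0 < \<alpha> t"
    and "0 \<le> \<gamma>" "0 < C"
    and bound: "\<And>t. 0 < t \<Longrightarrow> running_sup \<alpha> (t + 1) powr (2 * \<gamma>) / \<alpha> t \<le> C * t powr (- \<beta>)"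
    and "0 < t"
  shows "\<alpha> 0 powr (2 * \<gamma>) / C * t powr \<beta> \<le> \<alpha> t"
proof -
  \<comment> \<open>Boundedness on the interval makes the \<open>SUP\<close> in
    \<open>running_sup\<close> a genuine supremum.\<close>
  have "compact (\<alpha> ` {0..t + 1})"
    by (intro compact_continuous_image continuous_on_subset[OF cont]) auto
  then have "bdd_above (\<alpha> ` {0..t + 1})"
    by (intro bounded_imp_bdd_above compact_imp_bounded)
  then have "\<alpha> 0 \<le> running_sup \<alpha> (t + 1)"
    unfolding running_sup_def using \<open>0 < t\<close> by (intro cSUP_upper) auto
  then have "\<alpha> 0 powr (2 * \<gamma>) \<le> running_sup \<alpha> (t + 1) powr (2 * \<gamma>)"
    using pos[of 0] \<open>0 \<le> \<gamma>\<close> by (intro powr_mono2) auto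
  also have "\<dots> \<le> C * t powr (- \<beta>) * \<alpha> t"
    using bound[OF \<open>0 < t\<close>] pos[of t] \<open>0 < t\<close> by (simp add: divide_le_eq)
  finally have "\<alpha> 0 powr (2 * \<gamma>) \<le> C * \<alpha> t / t powr \<beta>"
    by (simp add: powr_minus_divide)
  then show ?thesis using \<open>0 < C\<close> \<open>0 < t\<close> by (simp add: field_simps)
qed

text \<open>Time is cut into windows from \<open>2 ^ (m * (K - 1))\<close> to
  \<open>2 ^ (m * K)\<close>. In window \<open>K\<close> the rate is at least of order
  \<open>2 ^ K\<close>, so the relaxation time is at most comparable to the mesh, and
  \<open>W\<close> moves little over it.\<close>

lemma (in standard_brownian_motion) ornstein_uhlenbeck_AE_tendsto_zero:
  fixes \<alpha> :: "real \<Rightarrow> real" and X :: "real \<Rightarrow> 'a \<Rightarrow> real"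
  assumes cont: "continuous_on {0..} \<alpha>" and nonneg: "\<And>t. 0 \<le> t \<Longrightarrow> 0 \<le> \<alpha> t"
    and lower: "\<And>x. 0 < x \<Longrightarrow> c * x powr \<beta> \<le> \<alpha> x" and c: "0 < c" and \<beta>: "0 < \<beta>"
    and X: "\<And>t. 0 \<le> t \<Longrightarrow> is_wiener_integral M W t (\<lambda>s. exp (- integral {s..t} \<alpha>)) (X t)"
    and X_cont: "AE \<omega> in M. continuous_on {0..} (\<lambda>t. X t \<omega>)"
  shows "AE \<omega> in M. ((\<lambda>t. X t \<omega>) \<longlongrightarrow> 0) at_top"
proof -
  \<comment> \<open>Chosen so that \<open>(2 ^ (m * L)) powr \<beta> \<ge> 2 ^ L\<close>.\<close>
  define m where "m = nat \<lceil>1 / \<beta>\<rceil>"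
  have m: "1 \<le> real m * \<beta>"
  proof -
    have "1 / \<beta> \<le> real m" unfolding m_def by (rule real_nat_ceiling_ge)
    then show ?thesis using \<beta> by (simp add: field_simps)
  qed
  define r where "r = root 4 (1 / 2)"
  have r: "0 < r" "r ^ 4 = 1 / 2" by (auto simp: r_def)
  have r1: "r < 1"
  proof (rule ccontr)
    assume "\<not> r < 1"
    then have "1 \<le> r ^ 4" by (intro one_le_power) simp
    then show False using r by simp
  qed
  \<comment> \<open>\<open>a\<close> is the constant of \<open>dyadic_chaining\<close>;
    \<open>d\<close> makes \<open>2 * t powr \<beta> * (t - s)\<close> equal to \<open>d\<close>
    times the lower bound of \<open>rate_integral_ge_linear\<close>.\<close>
  define a where "a = 2 / (1 - r) + 1"
  define d where "d = 4 * 2 powr \<beta> / c"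
  have a: "0 \<le> a" and d: "0 \<le> d" using r r1 c by (auto simp: a_def d_def)
  have scale: "(t - s) * 2 ^ K \<le> d * integral {s..t} \<alpha>"
    if st: "0 \<le> s" "s \<le> t" and K: "K = Suc L" "2 ^ (m * L) \<le> t" for s t K L
  proof -
    have "0 < t" using K(2) by (rule less_le_trans[rotated]) simp
    have "(2::real) ^ L = 2 powr real L" by (simp add: powr_realpow)
    also have "\<dots> \<le> 2 powr (real m * real L * \<beta>)"
      using mult_left_mono[OF m, of "real L"] by (intro powr_mono) (auto simp: ac_simps)
    also have "\<dots> = (2 ^ (m * L)) powr \<beta>"
      by (simp add: powr_powr flip: powr_realpow)
    also have "\<dots> \<le> t powr \<beta>" using K(2) \<beta> by (intro powr_mono2) auto
    finally have "2 ^ L \<le> t powr \<beta>" .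
    then have "(t - s) * 2 ^ K \<le> (t - s) * (2 * t powr \<beta>)"
      using st K by (intro mult_left_mono) auto
    also have "\<dots> = d * (c * (t / 2) powr \<beta> * ((t - s) / 2))"
      using c \<open>0 < t\<close> by (simp add: d_def powr_divide)
    also have "\<dots> \<le> d * integral {s..t} \<alpha>"
      using st \<open>0 < t\<close> c \<beta> d
      by (intro mult_left_mono rate_integral_ge_linear[OF cont nonneg lower]) auto
    finally show ?thesis .
  qed
  \<comment> \<open>Each time has its own exceptional null set, so the bound is collected over
    countably many times only.\<close>
  have "AE \<omega> in M. \<forall>t\<in>{q\<in>\<rat>. 0 < q}. \<forall>B a d. 0 \<le> B \<longrightarrow> 0 \<le> d \<longrightarrow>
      (\<forall>s\<in>{0..t}. \<bar>W t \<omega> - W s \<omega>\<bar> \<le> B * (a + d * integral {s..t} \<alpha>)) \<longrightarrow> \<bar>X t \<omega>\<bar> \<le> B * (a + d)"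
  proof (subst AE_ball_countable)
    show "countable {q\<in>\<rat>. 0 < (q::real)}" by (rule countable_subset[OF _ countable_rat]) auto
  qed (intro ballI wiener_integral_pathwise_bound cont nonneg X, auto)
  with dyadic_increments_eventually_small[OF r, of m] continuous_paths X_cont
  show ?thesis
  proof eventually_elim
    case (elim \<omega>)
    obtain k0 where k0: "\<And>k j. k0 \<le> k \<Longrightarrow> j < 2 ^ ((m + 1) * k) \<Longrightarrow>
        \<bar>W (real (Suc j) / 2 ^ k) \<omega> - W (real j / 2 ^ k) \<omega>\<bar> \<le> r ^ k"
      using elim(1) by blast
    have rational: "\<bar>X t \<omega>\<bar> \<le> r ^ K1 * (a + d)" if t: "t \<in> \<rat>" "2 ^ (m * K1) \<le> t" and K1: "k0 \<le> K1" for t K1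
    proof -
      have "1 \<le> t" using t(2) by (rule order_trans[rotated]) simp
      have "m \<noteq> 0" using m by (intro notI) simp
      \<comment> \<open>The level whose window contains \<open>t\<close>: minimality of
        \<open>K\<close> gives \<open>2 ^ (m * L) \<le> t\<close> for its predecessor
        \<open>L\<close>, and \<open>2 ^ (m * K1) \<le> t\<close> forces
        \<open>K1 \<le> K\<close>.\<close>
      define K where "K = (LEAST K. t < 2 ^ (m * K))"
      obtain n where "t < 2 ^ n" using real_arch_pow[of 2 t] by auto
      also have "(2::real) ^ n \<le> 2 ^ (m * n)" using \<open>m \<noteq> 0\<close> by (intro power_increasing) auto
      finally have K: "t < 2 ^ (m * K)" unfolding K_def by (rule LeastI)
      have "K \<noteq> 0" using K \<open>1 \<le> t\<close> by (intro notI) simp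
      then obtain L where L: "K = Suc L" by (cases K) auto
      have tL: "2 ^ (m * L) \<le> t"
        using not_less_Least[of L "\<lambda>K. t < 2 ^ (m * K)"] L by (simp add: K_def[symmetric])
      have "K1 \<le> K"
      proof (rule ccontr)
        assume "\<not> K1 \<le> K"
        then have "(2::real) ^ (m * K) \<le> 2 ^ (m * K1)" by (intro power_increasing) auto
        then show False using K t by linarith
      qed
      have "\<bar>X t \<omega>\<bar> \<le> r ^ K * (a + d)"
      proof -
        have "\<bar>W t \<omega> - W s \<omega>\<bar> \<le> r ^ K * (a + d * integral {s..t} \<alpha>)" if s: "s \<in> {0..t}" for s
        proof -
          have "\<bar>W t \<omega> - W s \<omega>\<bar> \<le> r ^ K * (2 / (1 - r) + 1 + (t - s) * 2 ^ K)"
            using s K K1 \<open>K1 \<le> K\<close> by (intro dyadic_chaining[OF elim(2) r(1) r1 k0]) auto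
          also have "\<dots> \<le> r ^ K * (a + d * integral {s..t} \<alpha>)"
            unfolding a_def[symmetric] using scale[OF _ _ L tL] s r
            by (intro mult_left_mono add_left_mono) auto
          finally show ?thesis .
        qed
        then show ?thesis using elim(4) t \<open>1 \<le> t\<close> r d by simp
      qed
      also have "\<dots> \<le> r ^ K1 * (a + d)"
        using \<open>K1 \<le> K\<close> r r1 a d by (intro mult_right_mono power_decreasing) auto
      finally show ?thesis .
    qed
    have real: "\<bar>X t \<omega>\<bar> \<le> r ^ K1 * (a + d)" if t: "2 ^ (m * K1) \<le> t" and K1: "k0 \<le> K1" for t K1
    proof (rule ccontr)
      assume neg: "\<not> \<bar>X t \<omega>\<bar> \<le> r ^ K1 * (a + d)"
      have "0 \<le> t" using t by (rule order_trans[rotated]) simp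
      then have "((\<lambda>t. X t \<omega>) \<longlongrightarrow> X t \<omega>) (at t within {0..})"
        using elim(3) by (simp add: continuous_on_def)
      then have "((\<lambda>t. \<bar>X t \<omega>\<bar>) \<longlongrightarrow> \<bar>X t \<omega>\<bar>) (at t within {0..})" by (rule tendsto_rabs)
      then have "eventually (\<lambda>t. r ^ K1 * (a + d) < \<bar>X t \<omega>\<bar>) (at t within {0..})"
        using neg by (intro order_tendstoD) auto
      then obtain e where e: "0 < e" "\<And>x. 0 \<le> x \<Longrightarrow> x \<noteq> t \<Longrightarrow> dist x t < e \<Longrightarrow> r ^ K1 * (a + d) < \<bar>X x \<omega>\<bar>"
        unfolding eventually_at by auto
      \<comment> \<open>A rational to the right of \<open>t\<close> stays above
        \<open>2 ^ (m * K1)\<close>, so the bound for rational times applies to it.\<close>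
      obtain q where q: "q \<in> \<rat>" "t < q" "q < t + e"
        using Rats_dense_in_real[of t "t + e"] e(1) by auto
      then have "r ^ K1 * (a + d) < \<bar>X q \<omega>\<bar>" using e \<open>0 \<le> t\<close> by (auto simp: dist_real_def)
      moreover have "\<bar>X q \<omega>\<bar> \<le> r ^ K1 * (a + d)" using q t K1 by (intro rational) auto
      ultimately show False by simp
    qed
    show ?case
    proof (rule tendstoI)
      fix e :: real assume "0 < e"
      have "(\<lambda>K. r ^ K * (a + d)) \<longlonglongrightarrow> 0 * (a + d)"
        using r r1 by (intro tendsto_mult tendsto_const LIMSEQ_power_zero) auto
      then have "eventually (\<lambda>K. r ^ K * (a + d) < e) sequentially"
        using \<open>0 < e\<close> by (intro order_tendstoD) auto
      then have "eventually (\<lambda>K. r ^ K * (a + d) < e \<and> k0 \<le> K) sequentially"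
        by (intro eventually_conj eventually_ge_at_top)
      then obtain K1 where K1: "r ^ K1 * (a + d) < e" "k0 \<le> K1"
        unfolding eventually_sequentially by blast
      show "eventually (\<lambda>t. dist (X t \<omega>) 0 < e) at_top"
        using eventually_ge_at_top[of "2 ^ (m * K1)"]
      proof eventually_elim
        case (elim t)
        then show ?case using real[OF elim K1(2)] K1(1) by simp
      qed
    qed
  qed
qed

theorem theorem2p1:
  fixes M :: "'a measure" and F :: "real \<Rightarrow> 'a measure" and W :: "real \<Rightarrow> 'a \<Rightarrow> real"
    and \<alpha> \<alpha>' :: "real \<Rightarrow> real" and X :: "ennreal \<Rightarrow> 'a \<Rightarrow> real"
  assumes brownian: "standard_brownian_motion M F W"
    and alpha_pos: "\<And>t. 0 \<le> t \<Longrightarrow> 0 < \<alpha> t"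
    and alpha_deriv: "\<And>t. 0 \<le> t \<Longrightarrow> (\<alpha> has_real_derivative \<alpha>' t) (at t within {0..})"
    and alpha_C1: "continuous_on {0..} \<alpha>'"
    and cond_i: "\<exists>\<gamma> \<beta> C. 0 \<le> \<gamma> \<and> \<gamma> \<le> 1 / 2 \<and> 0 < \<beta> \<and> 0 < C \<and>
      (\<forall>t>0. running_sup \<alpha> (t + 1) powr (2 * \<gamma>) / \<alpha> t \<le> C * t powr (- \<beta>))"
    and cond_ii: "\<exists>C>0. \<forall>t\<ge>0. \<bar>\<alpha>' t / \<alpha> t\<bar> \<le> C"
    and X_finite: "\<And>t::real. 0 \<le> t \<Longrightarrow>
      is_wiener_integral M W t (\<lambda>s. exp (- integral {s..t} \<alpha>)) (X (ennreal t))"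
    and X_version: "AE \<omega> in M. continuous_on {0..} (\<lambda>t::real. X (ennreal t) \<omega>)"
    and X_infinity: "\<And>\<omega>. \<omega> \<in> space M \<Longrightarrow> X \<infinity> \<omega> = 0"
  shows "centered_gaussian_process M UNIV X \<and>
    (AE \<omega> in M. continuous_on_closed_horizon (\<lambda>t. X t \<omega>)) \<and>
    (AE \<omega> in M. ((\<lambda>t::real. X (ennreal t) \<omega>) \<longlongrightarrow> 0) at_top)"
proof -
  interpret standard_brownian_motion M F W by (rule brownian)
  have cont: "continuous_on {0..} \<alpha>"
    using alpha_deriv by (intro DERIV_continuous_on) auto
  obtain \<gamma> \<beta> C where cond: "0 \<le> \<gamma>" "0 < \<beta>" "0 < C"
    "\<And>t. 0 < t \<Longrightarrow> running_sup \<alpha> (t + 1) powr (2 * \<gamma>) / \<alpha> t \<le> C * t powr (- \<beta>)"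
    using cond_i by blast
  \<comment> \<open>This quotient is the constant \<open>c\<close> of the decay lemma.\<close>
  have "0 < \<alpha> 0 powr (2 * \<gamma>) / C" using alpha_pos[of 0] cond by simp
  with rate_power_lower_bound[OF cont alpha_pos cond(1,3,4)]
  have lim: "AE \<omega> in M. ((\<lambda>t::real. X (ennreal t) \<omega>) \<longlongrightarrow> 0) at_top"
    by (intro ornstein_uhlenbeck_AE_tendsto_zero[OF cont less_imp_le[OF alpha_pos] _ _ cond(2) X_finite X_version])
      auto
  have closed: "AE \<omega> in M. continuous_on_closed_horizon (\<lambda>t. X t \<omega>)"
    using lim X_version AE_space
    by eventually_elim (simp add: continuous_on_closed_horizon_def X_infinity del: infinity_ennreal_def)
  \<comment> \<open>All \<open>X i\<close>, the one at \<infinity> included, lie in one Gaussian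
    space; hence every linear combination is normal, which is more than normality of each
    variable.\<close>
  have mem: "X i \<in> L2_closure M (brownian_span W)" for i
  proof (cases i)
    case (real t)
    then show ?thesis using wiener_integral_L2_closure[OF X_finite] by simp
  next
    case top
    have "(\<lambda>_. 0) \<in> L2_closure M (brownian_span W)"
      by (simp add: L2_closure_superset brownian_span_0)
    then show ?thesis by (rule L2_closure_cong) (simp add: X_infinity top flip: infinity_ennreal_def)
  qed
  have "gaussian_rv M (\<lambda>\<omega>. \<Sum>i\<in>J. c i * X i \<omega>)" if "finite J" for J c
    using L2_closure_brownian_span_centered_normal[OF
        L2_closure_brownian_span_combination[of J X c, OF that mem]]
      centered_normal_gaussian_rv by blast
  moreover have "expectation (X i) = 0" for i
    using L2_closure_brownian_span_centered_normal[OF mem] centered_normal_expectation by blast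
  ultimately have "centered_gaussian_process M UNIV X"
    by (simp add: centered_gaussian_process_def gaussian_process_def)
  with closed lim show ?thesis by blast
qed

end
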